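(* Let $1\le p<\infty$, $q=p(p-1)^{-1}$, $0\le\beta<1-\frac1p$, $r\in\mathbb{N}$, let $f\in L^{p}$, let $x\in\mathbb{R}$, and let $\widetilde\omega$ be a function of the modulus of continuity type. Put $M_r=\{0,1,\dots,[r/2]\}$ if $r$ is odd and $M_r=\{0,1,\dots,[r/2]-1\}$ if $r$ is even. Assume there are $\gamma$ with $0<\gamma<\beta+\frac1p$ and a constant $C$ (possibly depending on $x$, but not on $n$) such that for all integers $n\ge0$: (i) $\left\{\int_{0}^{\frac{\pi}{r(n+1)}}\left(\frac{t|\psi_x(t)|}{\widetilde\omega(t)}\right)^{p}\sin^{\beta p}\frac{t}{2}\,dt\right\}^{1/p}\le C(n+1)^{-1}$; (ii) for every $m\in M_r$: $\left\{\int_{\frac{2m\pi}{r}+\frac{\pi}{r(n+1)}}^{\frac{2m\pi}{r}+\frac{\pi}{r}}\left(\frac{|\psi_x(t)|}{\widetilde\omega(t)(t-\frac{2m\pi}{r})^{\gamma}}\right)^{p}\left|\sin\frac{rt}{2}\right|^{\beta p}dt\right\}^{1/p}\le C(n+1)^{\gamma}$; (iii) if $r\ge2$: $\left\{\int_{0}^{\frac{\pi}{r(n+1)}}\left(\frac{\widetilde\omega(t)}{t\sin^{\beta}\frac{rt}{2}}\right)^{q}dt\right\}^{1/q}\le C(n+1)^{\beta+1/p}\widetilde\omega\!\left(\frac{\pi}{n+1}\right)$, and for every $m\in M_r$: $\left\{\int_{\frac{2m\pi}{r}}^{\frac{2m\pi}{r}+\frac{\pi}{r(n+1)}}\left(\frac{|\psi_x(t)|}{\widetilde\omega(t)}\right)^{p}\left|\sin\frac{rt}{2}\right|^{\beta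 p}dt\right\}^{1/p}\le C(n+1)^{-1/p}$; (iv) if $r\ge2$, then for every $m\in\{0,1,\dots,[r/2]-1\}$: $\left\{\int_{\frac{2(m+1)\pi}{r}-\frac{\pi}{r(n+1)}}^{\frac{2(m+1)\pi}{r}}\left(\frac{|\psi_x(t)|}{\widetilde\omega(t)}\right)^{p}\left|\sin\frac{rt}{2}\right|^{\beta p}dt\right\}^{1/p}\le C(n+1)^{-1/p}$ and $\left\{\int_{\frac{2(m+1)\pi}{r}-\frac{\pi}{r}}^{\frac{2(m+1)\pi}{r}-\frac{\pi}{r(n+1)}}\left(\frac{|\psi_x(t)|\,|\sin\frac{rt}{2}|^{\beta}}{\widetilde\omega(t)(\frac{2(m+1)\pi}{r}-t)^{\gamma}}\right)^{p}dt\right\}^{1/p}\le C(n+1)^{\gamma}$; (v) the matrix $A$ satisfies $\left[\sum_{l=0}^{n}\sum_{k=l}^{r+l-1}a_{n,k}\right]^{-1}\le C$ and $\sum_{k=0}^{\infty}(k+1)^2a_{n,k}\le C(n+1)^2$. Then there is a constant $C'$ (possibly depending on $x$) such that for all $n\ge0$, $$\left|\widetilde T_{n,A}f(x)-\widetilde f\!\left(x,\frac{\pi}{n+1}\right)\right|\le C'(n+1)^{\beta+\frac1p+1}A_{n,r}\,\widetilde\omega\!\left(\frac{\pi}{n+1}\right).$$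
   Context: $L^{p}$ ($1\le p<\infty$) is the space of $2\pi$-periodic real functions that are Lebesgue integrable with $p$-th power over $[-\pi,\pi]$. For $f\in L^1$ with Fourier coefficients $a_\nu(f),b_\nu(f)$, the conjugate series is $\sum_{\nu\ge1}(a_\nu(f)\sin\nu x-b_\nu(f)\cos\nu x)$, with $k$-th partial sums $\widetilde S_kf(x)$. $\psi_x(t)=f(x+t)-f(x-t)$ and, for $\epsilon>0$, $\widetilde f(x,\epsilon)=-\frac1\pi\int_\epsilon^\pi\psi_x(t)\frac12\cot\frac t2\,dt$. $A=(a_{n,k})_{n,k\ge0}$ is an infinite real matrix with $a_{n,k}\ge0$, $\lim_{n\to\infty}a_{n,k}=0$ for each $k$, and $\sum_{k=0}^\infty a_{n,k}=1$ for each $n$; $\widetilde T_{n,A}f(x)=\sum_{k=0}^\infty a_{n,k}\widetilde S_kf(x)$, and $A_{n,r}=\sum_{k=0}^\infty|a_{n,k}-a_{n,k+r}|$. A function of the modulus of continuity type is a nondecreasing continuous function $\widetilde\omega$ on $[0,2\pi]$ with $\widetilde\omega(0)=0$ and $\widetilde\omega(\delta_1+\delta_2)\le\widetilde\omega(\delta_1)+\widetilde\omega(\delta_2)$ whenever $0\le\delta_1\le\delta_2\le\delta_1+\delta_2\le2\pi$. $[y]$ denotes the integer part of $y$. When $p=1$ (so $q=\infty$), $\{\int g^q\}^{1/q}$ is read as the essential supremum of $g$. *)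

theory Defs
  imports "HOL-Analysis.Analysis" "HOL-Probability.Essential_Supremum"
begin

definition Lp_periodic :: "real \<Rightarrow> (real \<Rightarrow> real) \<Rightarrow> bool" where
  "Lp_periodic p f \<longleftrightarrow> (\<forall>x. f (x + 2*pi) = f x) \<and> f \<in> borel_measurable lebesgue
     \<and> set_integrable lebesgue {-pi..pi} (\<lambda>t. \<bar>f t\<bar> powr p)"

definition four_a :: "(real \<Rightarrow> real) \<Rightarrow> nat \<Rightarrow> real" where
  "four_a f \<nu> = (1/pi) * (LINT t:{-pi..pi}|lebesgue. f t * cos (real \<nu> * t))"

definition four_b :: "(real \<Rightarrow> real) \<Rightarrow> nat \<Rightarrow> real" where
  "four_b f \<nu> = (1/pi) * (LINT t:{-pi..pi}|lebesgue. f t * sin (real \<nu> * t))"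

definition conj_partial_sum :: "(real \<Rightarrow> real) \<Rightarrow> nat \<Rightarrow> real \<Rightarrow> real" where
  "conj_partial_sum f k x = (\<Sum>\<nu>=1..k. four_a f \<nu> * sin (real \<nu> * x) - four_b f \<nu> * cos (real \<nu> * x))"

definition psi :: "(real \<Rightarrow> real) \<Rightarrow> real \<Rightarrow> real \<Rightarrow> real" where
  "psi f x t = f (x + t) - f (x - t)"

definition conj_trunc :: "(real \<Rightarrow> real) \<Rightarrow> real \<Rightarrow> real \<Rightarrow> real" where
  "conj_trunc f x \<epsilon> = - (1/pi) * (LINT t:{\<epsilon>..pi}|lebesgue. psi f x t * ((1/2) * cot (t/2)))"

definition summation_matrix :: "(nat \<Rightarrow> nat \<Rightarrow> real) \<Rightarrow> bool" where
  "summation_matrix a \<longleftrightarrow> (\<forall>n k. a n k \<ge> 0) \<and> (\<forall>k. (\<lambda>n. a n k) \<longlonglongrightarrow> 0)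
     \<and> (\<forall>n. (\<lambda>k. a n k) sums 1)"

definition T_conj :: "(nat \<Rightarrow> nat \<Rightarrow> real) \<Rightarrow> nat \<Rightarrow> (real \<Rightarrow> real) \<Rightarrow> real \<Rightarrow> real" where
  "T_conj a n f x = (\<Sum>k. a n k * conj_partial_sum f k x)"

definition A_nr :: "(nat \<Rightarrow> nat \<Rightarrow> real) \<Rightarrow> nat \<Rightarrow> nat \<Rightarrow> real" where
  "A_nr a n r = (\<Sum>k. \<bar>a n k - a n (k + r)\<bar>)"

definition modulus_type :: "(real \<Rightarrow> real) \<Rightarrow> bool" where
  "modulus_type w \<longleftrightarrow> mono_on {0..2*pi} w \<and> continuous_on {0..2*pi} w \<and> w 0 = 0
     \<and> (\<forall>d1 d2. 0 \<le> d1 \<and> d1 \<le> d2 \<and> d2 \<le> d1 + d2 \<and> d1 + d2 \<le> 2*pi \<longrightarrow> w (d1 + d2) \<le> w d1 + w d2)"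

definition Lp_norm_le :: "real \<Rightarrow> real set \<Rightarrow> (real \<Rightarrow> real) \<Rightarrow> real \<Rightarrow> bool" where
  "Lp_norm_le p S g B \<longleftrightarrow> set_integrable lebesgue S (\<lambda>t. \<bar>g t\<bar> powr p)
     \<and> (LINT t:S|lebesgue. \<bar>g t\<bar> powr p) powr (1/p) \<le> B"

definition esssup_le :: "real set \<Rightarrow> (real \<Rightarrow> real) \<Rightarrow> real \<Rightarrow> bool" where
  "esssup_le S g B \<longleftrightarrow> esssup (restrict_space lebesgue S) (\<lambda>t. ereal (g t)) \<le> ereal B"

text \<open>{ int_S g^q }^(1/q) <= B with q = p/(p-1); for p = 1 (q = infinity) read as ess sup.\<close>
definition Lq_norm_le :: "real \<Rightarrow> real set \<Rightarrow> (real \<Rightarrow> real) \<Rightarrow> real \<Rightarrow> bool" where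
  "Lq_norm_le p S g B \<longleftrightarrow> (if p = 1 then esssup_le S g B else Lp_norm_le (p / (p - 1)) S g B)"

end

theory Submission
  imports Defs
begin

text \<open>
  Write \<open>N = n + 1\<close>. The difference to be estimated is \<open>-1/\<pi>\<close> times the integral of \<open>\<psi>\<^sub>x L\<close> over
  \<open>[0, \<pi>]\<close>, where \<open>L\<close> is the averaged conjugate Dirichlet kernel with \<open>cot (t/2) / 2\<close> removed on
  \<open>[\<pi>/N, \<pi>]\<close>. The second moment condition gives \<open>L = O(N\<^sup>2 t)\<close> near the origin and \<open>L = O(1/t)\<close>
  everywhere, and Abel summation with step \<open>r\<close> gives \<open>L = O(A / (t |sin (r t / 2)|))\<close> with
  \<open>A = A\<^sub>n\<^sub>,\<^sub>r\<close>; the lower bound on the block sums says that \<open>N A\<close> is bounded below. Around every zero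
  of \<open>sin (r t / 2)\<close> the interval is split at distance \<open>\<pi> / (r N)\<close>. On each piece Hoelder's inequality
  is applied to the given weighted \<open>L\<^sup>p\<close> bound for \<open>\<psi>\<^sub>x\<close> and a power of the distance to the zero,
  while subadditivity of the modulus gives \<open>w(t)/t = O(N w(\<pi>/N))\<close> away from the origin.
  The hypotheses on \<open>\<beta>\<close> force \<open>p > 1\<close>.
\<close>

section \<open>Hoelder's inequality and power weights\<close>

text \<open>The Abel bound on the kernel degenerates exactly at the zeros of sin (r t / 2). Within
  distance pi / (r N) of a zero only O(1/t), or O(N^2 t) at the origin, is available, and the factor
  A is missing. The lower bound on N A buys it back at the price of one power of N. The near pieces
  can afford this, since before it they contribute at most N^(\<beta> + 1/p) v with v = w(pi/N). On
  the far pieces A comes from Abel summation itself and the powers of N add up to exactly \<beta> +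
  1/p + 1; this is the origin of the exponent in the theorem. The two strict inequalities on the
  exponents are integrability conditions on the dual power: \<beta> q < 1 makes |t - c|^(-\<beta>)
  q-integrable at a zero c, and (1 + \<beta> - \<gamma>) q > 1 lets the far integral be governed by
  its inner endpoint. The final constant must be uniform in n, so N, A and v are parameters of a
  locale whose constants are defined without them.\<close>

lemma sin_ge_two_pi_mult:
  fixes y :: real
  assumes "0 \<le> y" "y \<le> pi/2"
  shows "2/pi * y \<le> sin y"
proof -
  \<comment> \<open>This is Jordan's inequality: sin is concave here, so it lies above the chord
    from the origin to (pi/2, 1).\<close>
  have cvx: "convex_on {0..pi/2} (\<lambda>x. - sin x)"
  proof (rule f''_ge0_imp_convex[where f' = "\<lambda>x. - cos x" and f'' = sin])
    show "0 \<le> sin x" if "x \<in> {0..pi/2}" for x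
      using that by (intro sin_ge_zero) auto
  qed (auto intro!: derivative_eq_intros)
  have "- sin ((1 - 2*y/pi) *\<^sub>R 0 + (2*y/pi) *\<^sub>R (pi/2)) \<le> (1 - 2*y/pi) * (- sin 0) + (2*y/pi) * (- sin (pi/2))"
    by (rule convex_onD[OF cvx]) (use assms in \<open>auto simp: field_simps\<close>)
  then show ?thesis by (simp add: field_simps)
qed

lemma abs_sin_npi_plus: "\<bar>sin (real m * pi + y)\<bar> = \<bar>sin y\<bar>"
  by (simp add: sin_add abs_mult)

lemma Lp_norm_le_integral:
  assumes "p > 0" "Lp_norm_le p S g B"
  shows "(LINT t:S|lebesgue. \<bar>g t\<bar> powr p) \<le> B powr p"
proof -
  let ?I = "LINT t:S|lebesgue. \<bar>g t\<bar> powr p"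
  have "?I \<ge> 0"
    unfolding set_lebesgue_integral_def by (intro Bochner_Integration.integral_nonneg) auto
  then have "?I = (?I powr (1/p)) powr p"
    using assms by (simp add: powr_powr)
  also have "\<dots> \<le> B powr p"
    using assms by (intro powr_mono2) (auto simp: Lp_norm_le_def)
  finally show ?thesis .
qed

text \<open>Young's inequality is applied pointwise to |g|/B and |k|/K and then integrated.
  Normalising by the given bounds instead of the actual norms removes the case of a vanishing
  norm.\<close>

lemma nn_integral_Holder:
  fixes p q :: real
  assumes p: "p > 1" and q: "q = p / (p - 1)" and B: "B > 0" and K: "K > 0"
    and g: "Lp_norm_le p S g B" and k: "Lp_norm_le q S k K"
  shows "(\<integral>\<^sup>+t\<in>S. ennreal (\<bar>g t\<bar> * \<bar>k t\<bar>) \<partial>lebesgue) \<le> ennreal (B * K)"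
proof -
  define u where "u t = indicator S t * \<bar>g t\<bar> powr p" for t
  define v where "v t = indicator S t * \<bar>k t\<bar> powr q" for t
  \<comment> \<open>Chosen so that \<open>b * B powr p = B * K / p\<close> and
    \<open>c * K powr q = B * K / q\<close>; conjugacy of the exponents makes the total B K.\<close>
  define b where "b = B * K / (B powr p * p)"
  define c where "c = B * K / (K powr q * q)"
  have q1: "q > 1" and pq: "1/p + 1/q = 1"
    using p by (auto simp: q field_simps)
  have uv: "u t \<ge> 0" "v t \<ge> 0" for t by (auto simp: u_def v_def)
  have bc: "b \<ge> 0" "c \<ge> 0" using B K p q1 by (auto simp: b_def c_def)
  have int: "integrable lebesgue u" "integrable lebesgue v"
    using g k by (auto simp: Lp_norm_le_def set_integrable_def u_def[abs_def] v_def[abs_def])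
  have I: "integral\<^sup>L lebesgue u \<le> B powr p" "integral\<^sup>L lebesgue v \<le> K powr q"
    using Lp_norm_le_integral[OF _ g] Lp_norm_le_integral[OF _ k] p q1
    by (auto simp: set_lebesgue_integral_def u_def[abs_def] v_def[abs_def])
  have "(\<integral>\<^sup>+t\<in>S. ennreal (\<bar>g t\<bar> * \<bar>k t\<bar>) \<partial>lebesgue) \<le> (\<integral>\<^sup>+t. ennreal (b * u t + c * v t) \<partial>lebesgue)"
  proof (intro nn_integral_mono)
    fix t :: real
    have "\<bar>g t\<bar> * \<bar>k t\<bar> = B * K * ((\<bar>g t\<bar> / B) * (\<bar>k t\<bar> / K))"
      using B K by simp
    also have "\<dots> \<le> B * K * ((\<bar>g t\<bar> / B) powr p / p + (\<bar>k t\<bar> / K) powr q / q)"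
      using B K p q1 pq by (intro mult_left_mono Youngs_inequality) auto
    also have "\<dots> = b * \<bar>g t\<bar> powr p + c * \<bar>k t\<bar> powr q"
      using B K by (simp add: b_def c_def powr_divide field_simps)
    finally show "ennreal (\<bar>g t\<bar> * \<bar>k t\<bar>) * indicator S t \<le> ennreal (b * u t + c * v t)"
      by (auto simp: u_def v_def indicator_def intro: ennreal_leI)
  qed
  also have "\<dots> = ennreal (\<integral>t. b * u t + c * v t \<partial>lebesgue)"
    using int bc
    by (intro nn_integral_eq_integral) (auto intro!: AE_I2 add_nonneg_nonneg mult_nonneg_nonneg simp: uv)
  also have "\<dots> \<le> ennreal (B * K)"
  proof (rule ennreal_leI)
    have "(\<integral>t. b * u t + c * v t \<partial>lebesgue) = b * integral\<^sup>L lebesgue u + c * integral\<^sup>L lebesgue v"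
      using int by simp
    also have "\<dots> \<le> b * B powr p + c * K powr q"
      using bc I by (intro add_mono mult_left_mono) auto
    also have "\<dots> = B * K * (1/p + 1/q)"
      using B K by (simp add: b_def c_def field_simps)
    finally show "(\<integral>t. b * u t + c * v t \<partial>lebesgue) \<le> B * K" using pq by simp
  qed
  finally show ?thesis .
qed

text \<open>Domination is asked for on the open interval because the endpoints form a null set, and
  a singularity of the dual power, if it meets the interval at all, sits at an endpoint in every
  application.\<close>

lemma nn_integral_le_Holder:
  fixes p q :: real
  assumes "p > 1" "q = p / (p - 1)" "B > 0" "K > 0" "D \<ge> 0"
    and "Lp_norm_le p {lo..hi} g B" "Lp_norm_le q {lo..hi} k K"
    and u: "\<And>t. lo < t \<Longrightarrow> t < hi \<Longrightarrow> \<bar>u t\<bar> \<le> D * (\<bar>g t\<bar> * \<bar>k t\<bar>)"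
  shows "(\<integral>\<^sup>+t\<in>{lo..hi}. ennreal \<bar>u t\<bar> \<partial>lebesgue) \<le> ennreal (D * (B * K))"
proof -
  have ae: "AE t in lebesgue. t \<notin> {lo, hi}"
    by (intro AE_not_in) (simp flip: negligible_iff_null_sets)
  have meas: "(\<lambda>t. ennreal (\<bar>g t\<bar> * \<bar>k t\<bar>) * indicator {lo..hi} t) \<in> borel_measurable lebesgue"
  proof -
    have *: "(\<lambda>t. indicator {lo..hi} t * \<bar>h t\<bar>) \<in> borel_measurable lebesgue"
      if "s > 0" "Lp_norm_le s {lo..hi} h b" for s h b
    proof -
      have "(\<lambda>t. indicator {lo..hi} t * \<bar>h t\<bar> powr s) \<in> borel_measurable lebesgue"
        using that by (auto simp: Lp_norm_le_def set_integrable_def)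
      \<comment> \<open>\<open>Lp_norm_le\<close> provides measurability of the power |h|^s on the
        interval; the root recovers it for |h| itself.\<close>
      then have "(\<lambda>t. (indicator {lo..hi} t * \<bar>h t\<bar> powr s) powr (1/s)) \<in> borel_measurable lebesgue"
        by measurable
      also have "(\<lambda>t. (indicator {lo..hi} t * \<bar>h t\<bar> powr s) powr (1/s)) = (\<lambda>t. indicator {lo..hi} t * \<bar>h t\<bar>)"
        using that by (auto simp: powr_powr indicator_def)
      finally show ?thesis .
    qed
    have "q > 0" using assms(1,2) by simp
    have "(\<lambda>t. ennreal ((indicator {lo..hi} t * \<bar>g t\<bar>) * (indicator {lo..hi} t * \<bar>k t\<bar>))) \<in> borel_measurable lebesgue"
      using *[of p g B] *[of q k K] \<open>q > 0\<close> assms(1,6,7)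
      by (intro measurable_compose[OF _ measurable_ennreal] borel_measurable_times[of "\<lambda>t. indicator {lo..hi} t * \<bar>g t\<bar>"]) auto
    also have "(\<lambda>t. ennreal ((indicator {lo..hi} t * \<bar>g t\<bar>) * (indicator {lo..hi} t * \<bar>k t\<bar>)))
       = (\<lambda>t. ennreal (\<bar>g t\<bar> * \<bar>k t\<bar>) * indicator {lo..hi} t)"
      by (auto simp: indicator_def)
    finally show ?thesis .
  qed
  have "(\<integral>\<^sup>+t\<in>{lo..hi}. ennreal \<bar>u t\<bar> \<partial>lebesgue)
     \<le> (\<integral>\<^sup>+t. ennreal D * (ennreal (\<bar>g t\<bar> * \<bar>k t\<bar>) * indicator {lo..hi} t) \<partial>lebesgue)"
  proof (rule nn_integral_mono_AE, use ae in eventually_elim)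
    case (elim t)
    then show ?case
      using u[of t] \<open>D \<ge> 0\<close> by (auto simp: indicator_def ennreal_mult[symmetric] intro!: ennreal_leI)
  qed
  also have "\<dots> = ennreal D * (\<integral>\<^sup>+t\<in>{lo..hi}. ennreal (\<bar>g t\<bar> * \<bar>k t\<bar>) \<partial>lebesgue)"
    by (rule nn_integral_cmult[OF meas])
  also have "\<dots> \<le> ennreal D * ennreal (B * K)"
    using assms(1-4,6,7) by (intro mult_left_mono nn_integral_Holder) auto
  finally show ?thesis
    using assms(3-5) by (simp add: ennreal_mult)
qed

section \<open>Explicit norms of powers of the distance to a point\<close>

lemma has_integral_abs_diff_powr:
  fixes c d e h :: real
  assumes "0 \<le> h" "h \<le> d" "e \<noteq> -1" and e: "h = 0 \<Longrightarrow> e > -1"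
  shows "((\<lambda>t. \<bar>t - c\<bar> powr e) has_integral (d powr (e+1) - h powr (e+1)) / (e+1)) {c+h..c+d}"
    and "((\<lambda>t. \<bar>t - c\<bar> powr e) has_integral (d powr (e+1) - h powr (e+1)) / (e+1)) {c-d..c-h}"
proof -
  have right: "((\<lambda>t. \<bar>t - c\<bar> powr e) has_integral (d powr (e+1) - h powr (e+1)) / (e+1)) {c+h..c+d}" for c
  proof -
    have "((\<lambda>t. \<bar>t - c\<bar> powr e) has_integral ((c + d - c) powr (e+1) / (e+1) - (c + h - c) powr (e+1) / (e+1))) {c+h..c+d}"
    proof (rule fundamental_theorem_of_calculus_interior)
      show "continuous_on {c+h..c+d} (\<lambda>t. (t - c) powr (e+1) / (e+1))"
      proof (cases "h = 0")
        case True
        \<comment> \<open>For h = 0 the antiderivative must still be continuous at the singular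
          endpoint, which is the condition e > -1.\<close>
        with e have "e + 1 > 0" by auto
        then show ?thesis using True
          by (intro continuous_intros continuous_on_powr') (auto)
      next
        case False
        then show ?thesis using assms by (intro continuous_intros) auto
      qed
      show "((\<lambda>t. (t - c) powr (e+1) / (e+1)) has_vector_derivative \<bar>t - c\<bar> powr e) (at t)"
        if "t \<in> {c+h<..<c+d}" for t
        unfolding has_real_derivative_iff_has_vector_derivative[symmetric]
        using that assms
        by (auto intro!: derivative_eq_intros simp: add_eq_0_iff)
    qed (use assms in auto)
    then show ?thesis by (simp add: diff_divide_distrib)
  qed
  show "((\<lambda>t. \<bar>t - c\<bar> powr e) has_integral (d powr (e+1) - h powr (e+1)) / (e+1)) {c+h..c+d}"
    by (rule right)
  have "((\<lambda>t. \<bar>- t - (- c)\<bar> powr e) has_integral (d powr (e+1) - h powr (e+1)) / (e+1)) {-(-c+d)..-(-c+h)}"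
    using right[of "-c"] by (subst has_integral_reflect_real) auto
  then show "((\<lambda>t. \<bar>t - c\<bar> powr e) has_integral (d powr (e+1) - h powr (e+1)) / (e+1)) {c-d..c-h}"
    by (simp add: abs_minus_commute)
qed

lemma Lp_norm_le_abs_diff_powr:
  assumes "q > 0" "B \<ge> 0" "((\<lambda>t. \<bar>t - c\<bar> powr (s * q)) has_integral I) S" "I \<le> B powr q"
  shows "Lp_norm_le q S (\<lambda>t. \<bar>t - c\<bar> powr s) B"
proof -
  have eq: "\<bar>\<bar>t - c\<bar> powr s\<bar> powr q = \<bar>t - c\<bar> powr (s * q)" for t
    by (simp add: powr_powr)
  have ai: "(\<lambda>t. \<bar>t - c\<bar> powr (s * q)) absolutely_integrable_on S"
    using assms by (intro nonnegative_absolutely_integrable_1) (auto simp: integrable_on_def)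
  have I: "(LINT t:S|lebesgue. \<bar>t - c\<bar> powr (s * q)) = I"
    using set_lebesgue_integral_eq_integral(2)[OF ai] assms(3) by (simp add: integral_unique)
  have "I \<ge> 0" using assms(3) by (rule has_integral_nonneg) auto
  then have "I powr (1/q) \<le> (B powr q) powr (1/q)"
    using assms by (intro powr_mono2) auto
  also have "\<dots> = B" using assms by (simp add: powr_powr)
  finally show ?thesis using ai I by (simp only: Lp_norm_le_def eq)
qed

text \<open>The exact integral of the q-th power is h^(1 - \<beta> q) / (1 - \<beta> q), and
  \<open>K\<close> is its q-th root; \<open>\<beta> * q < 1\<close> is integrability at the singular
  endpoint c.\<close>

lemma Lp_norm_le_powr_near:
  assumes "q > 0" "h > 0" "\<beta> * q < 1"
  defines "K \<equiv> (1 - \<beta> * q) powr (-1/q) * h powr (1/q - \<beta>)"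
  shows "Lp_norm_le q {c..c+h} (\<lambda>t. \<bar>t - c\<bar> powr (-\<beta>)) K"
    and "Lp_norm_le q {c-h..c} (\<lambda>t. \<bar>t - c\<bar> powr (-\<beta>)) K"
proof -
  have K: "K powr q = h powr (1 - \<beta>*q) / (1 - \<beta>*q)"
    using assms by (simp add: K_def powr_divide powr_mult powr_powr left_diff_distrib powr_minus_divide)
  have "K \<ge> 0" by (simp add: K_def)
  show "Lp_norm_le q {c..c+h} (\<lambda>t. \<bar>t - c\<bar> powr (-\<beta>)) K"
    using has_integral_abs_diff_powr(1)[of 0 h "-\<beta>*q" c] assms(1-3) \<open>K \<ge> 0\<close>
    by (intro Lp_norm_le_abs_diff_powr) (auto simp: K)
  show "Lp_norm_le q {c-h..c} (\<lambda>t. \<bar>t - c\<bar> powr (-\<beta>)) K"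
    using has_integral_abs_diff_powr(2)[of 0 h "-\<beta>*q" c] assms(1-3) \<open>K \<ge> 0\<close>
    by (intro Lp_norm_le_abs_diff_powr) (auto simp: K)
qed

text \<open>With \<open>s * q > 1\<close> the power is integrable at infinity. The term of the outer
  distance d enters with a negative sign and is dropped, so the bound depends on the inner distance
  h alone.\<close>

lemma Lp_norm_le_powr_far:
  assumes "q > 0" "0 < h" "h \<le> d" "s * q > 1"
  defines "K \<equiv> (s * q - 1) powr (-1/q) * h powr (1/q - s)"
  shows "Lp_norm_le q {c+h..c+d} (\<lambda>t. \<bar>t - c\<bar> powr (-s)) K"
    and "Lp_norm_le q {c-d..c-h} (\<lambda>t. \<bar>t - c\<bar> powr (-s)) K"
proof -
  have K: "K powr q = h powr (1 - s*q) / (s*q - 1)"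
    using assms by (simp add: K_def powr_divide powr_mult powr_powr left_diff_distrib powr_minus_divide)
  have "K \<ge> 0" by (simp add: K_def)
  have le: "(d powr (-s*q+1) - h powr (-s*q+1)) / (-s*q+1) \<le> K powr q"
  proof -
    have "(d powr (-s*q+1) - h powr (-s*q+1)) / (-s*q+1) = (h powr (1-s*q) - d powr (1-s*q)) / (s*q-1)"
      using assms by (simp add: field_simps)
    also have "\<dots> \<le> K powr q"
      unfolding K using assms by (intro divide_right_mono) auto
    finally show ?thesis .
  qed
  show "Lp_norm_le q {c+h..c+d} (\<lambda>t. \<bar>t - c\<bar> powr (-s)) K"
    using has_integral_abs_diff_powr(1)[of h d "-s*q" c] assms(1-4) \<open>K \<ge> 0\<close> le
    by (intro Lp_norm_le_abs_diff_powr) auto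
  show "Lp_norm_le q {c-d..c-h} (\<lambda>t. \<bar>t - c\<bar> powr (-s)) K"
    using has_integral_abs_diff_powr(2)[of h d "-s*q" c] assms(1-4) \<open>K \<ge> 0\<close> le
    by (intro Lp_norm_le_abs_diff_powr) auto
qed

section \<open>Summation of the kernels\<close>

lemma sum_sin_closed_form:
  fixes t :: real
  shows "2 * sin (t/2) * (\<Sum>\<nu>=1..k. sin (real \<nu> * t)) = cos (t/2) - cos ((real k + 1/2) * t)"
proof (induction k)
  case (Suc k)
  have "2 * sin (t/2) * sin (real (Suc k) * t)
      = cos (real (Suc k) * t - t/2) - cos (real (Suc k) * t + t/2)"
    by (simp add: cos_add cos_diff)
  also have "\<dots> = cos ((real k + 1/2) * t) - cos ((real (Suc k) + 1/2) * t)"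
    by (rule arg_cong2[where f = "\<lambda>a b. cos a - cos b"]) (simp_all add: algebra_simps)
  finally show ?case using Suc by (simp add: distrib_left)
qed simp

text \<open>The first bound serves to exchange sum and integral. The second vanishes at t = 0, and
  its square weight is that of the second moment hypothesis, so averaging yields a kernel of size
  N^2 |t|.\<close>

lemma abs_sum_sin_le:
  fixes t :: real
  shows "\<bar>\<Sum>\<nu>=1..k. sin (real \<nu> * t)\<bar> \<le> real k" "\<bar>\<Sum>\<nu>=1..k. sin (real \<nu> * t)\<bar> \<le> (real k + 1)^2 * \<bar>t\<bar>"
proof -
  have "\<bar>\<Sum>\<nu>=1..k. sin (real \<nu> * t)\<bar> \<le> (\<Sum>\<nu>=1..k. 1)"
    by (rule order.trans[OF sum_abs]) (intro sum_mono abs_sin_le_one)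
  then show "\<bar>\<Sum>\<nu>=1..k. sin (real \<nu> * t)\<bar> \<le> real k" by simp
  have "\<bar>\<Sum>\<nu>=1..k. sin (real \<nu> * t)\<bar> \<le> (\<Sum>\<nu>=1..k. real k * \<bar>t\<bar>)"
  proof (rule order.trans[OF sum_abs], rule sum_mono)
    fix \<nu> assume "\<nu> \<in> {1..k}"
    then show "\<bar>sin (real \<nu> * t)\<bar> \<le> real k * \<bar>t\<bar>"
      by (intro order.trans[OF abs_sin_x_le_abs_x]) (auto simp: abs_mult intro!: mult_right_mono)
  qed
  also have "\<dots> = (real k * real k) * \<bar>t\<bar>" by simp
  also have "\<dots> \<le> (real k + 1)^2 * \<bar>t\<bar>"
    by (intro mult_right_mono) (auto simp: power2_eq_square algebra_simps)
  finally show "\<bar>\<Sum>\<nu>=1..k. sin (real \<nu> * t)\<bar> \<le> (real k + 1)^2 * \<bar>t\<bar>" .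
qed

section \<open>Variation with step r of a summable nonnegative sequence\<close>

lemma summable_abs_shift_diff:
  fixes c :: "nat \<Rightarrow> real"
  assumes "summable c" "\<And>k. c k \<ge> 0"
  shows "summable (\<lambda>k. \<bar>c k - c (k + r)\<bar>)"
proof (rule summable_comparison_test')
  show "summable (\<lambda>k. c k + c (k + r))"
    using assms by (intro summable_add summable_ignore_initial_segment)
  show "norm \<bar>c k - c (k + r)\<bar> \<le> c k + c (k + r)" for k
    using assms(2)[of k] assms(2)[of "k+r"] by auto
qed

text \<open>A block of r consecutive terms is the tail from l minus the tail from l + r, that is,
  the sum of c(k) - c(k + r) over k >= l.\<close>

lemma sum_block_le_suminf_abs_shift_diff:
  fixes c :: "nat \<Rightarrow> real"
  assumes c: "summable c" "\<And>k. c k \<ge> 0"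
  shows "(\<Sum>k<r. c (l + k)) \<le> (\<Sum>k. \<bar>c k - c (k + r)\<bar>)"
proof -
  let ?d = "\<lambda>k. \<bar>c k - c (k + r)\<bar>"
  have s: "summable (\<lambda>k. c (l + k))" "summable (\<lambda>k. c (l + (k + r)))"
    using c(1) summable_iff_shift[of c l] summable_iff_shift[of c "l + r"] by (auto simp: algebra_simps)
  have sd: "summable (\<lambda>k. ?d (k + l))"
    using summable_abs_shift_diff[OF c] by (rule summable_ignore_initial_segment)
  have "(\<Sum>k<r. c (l + k)) = (\<Sum>k. c (l + k)) - (\<Sum>k. c (l + (k + r)))"
    using suminf_split_initial_segment[OF s(1), of r] by simp
  also have "\<dots> = (\<Sum>k. c (l + k) - c (l + (k + r)))"
    using s by (rule suminf_diff)
  also have "\<dots> \<le> (\<Sum>k. ?d (k + l))"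
    using s sd by (intro suminf_le summable_diff) (auto simp: algebra_simps)
  also have "\<dots> \<le> (\<Sum>k. ?d (k + l)) + (\<Sum>k<l. ?d k)"
    by (simp add: sum_nonneg)
  also have "\<dots> = (\<Sum>k. ?d k)"
    using suminf_split_initial_segment[OF summable_abs_shift_diff[OF c, of r], of l] by simp
  finally show ?thesis .
qed

text \<open>Combined with the lower bound on the block sums, this becomes
  \<open>1 \<le> C * N * A\<close>.\<close>

lemma sum_blocks_le_suminf_abs_shift_diff:
  fixes c :: "nat \<Rightarrow> real"
  assumes c: "summable c" "\<And>k. c k \<ge> 0" and r: "r \<ge> 1"
  shows "(\<Sum>l\<le>n. \<Sum>k=l..r+l-1. c k) \<le> (real n + 1) * (\<Sum>k. \<bar>c k - c (k + r)\<bar>)"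
proof -
  have "(\<Sum>k=l..r+l-1. c k) \<le> (\<Sum>k. \<bar>c k - c (k + r)\<bar>)" for l
  proof -
    have "(\<Sum>k=l..r+l-1. c k) = (\<Sum>k<r. c (l + k))"
      using r by (intro sum.reindex_bij_witness[of _ "\<lambda>k. l + k" "\<lambda>k. k - l"]) auto
    then show ?thesis using sum_block_le_suminf_abs_shift_diff[OF c] by simp
  qed
  then have "(\<Sum>l\<le>n. \<Sum>k=l..r+l-1. c k) \<le> (\<Sum>l\<le>n. (\<Sum>k. \<bar>c k - c (k + r)\<bar>))"
    by (intro sum_mono)
  then show ?thesis by (simp add: algebra_simps)
qed

text \<open>Abel summation with step \<open>r\<close>: multiplication by \<open>2 sin (r t / 2)\<close> turns \<open>cos ((k + 1/2) t)\<close>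
  into a difference of two terms whose indices differ by \<open>r\<close>.\<close>

lemma abs_sin_mult_suminf_cos_le:
  fixes c :: "nat \<Rightarrow> real" and t :: real
  assumes c: "summable c" "\<And>k. c k \<ge> 0"
  shows "\<bar>sin (real r * t / 2)\<bar> * \<bar>\<Sum>k. c k * cos ((real k + 1/2) * t)\<bar> \<le> (\<Sum>k. \<bar>c k - c (k + r)\<bar>)"
proof -
  \<comment> \<open>The phase is centred by r/2 so that the product formula for 2 sin (r t / 2) cos
    ((k + 1/2) t) reads s(k + r) - s(k).\<close>
  define s where "s j = sin ((real j + 1/2 - real r / 2) * t)" for j :: nat
  let ?A = "\<Sum>k. \<bar>c k - c (k + r)\<bar>"
  have s1: "\<bar>s j\<bar> \<le> 1" for j by (simp add: s_def)
  have bnd: "summable (\<lambda>k. c k * u k)" if "\<And>k. \<bar>u k\<bar> \<le> 1" for u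
  proof (rule summable_comparison_test'[OF c(1)])
    show "norm (c k * u k) \<le> c k" for k
      using mult_left_mono[OF that[of k] c(2)[of k]] c(2)[of k] by (simp add: abs_mult)
  qed
  have sum1: "summable (\<lambda>k. c k * s (k + r))" and sum2: "summable (\<lambda>k. c k * s k)"
    and sumc: "summable (\<lambda>k. c k * cos ((real k + 1/2) * t))"
    by (auto intro!: bnd s1)
  have sum3: "summable (\<lambda>k. c (k + r) * s (k + r))"
    using summable_ignore_initial_segment[OF sum2, of r] by simp
  have diff: "2 * sin (real r * t / 2) * cos ((real k + 1/2) * t) = s (k + r) - s k" for k
  proof -
    have "s (k + r) - s k = sin ((real k + 1/2) * t + real r * t / 2) - sin ((real k + 1/2) * t - real r * t / 2)"
      unfolding s_def by (rule arg_cong2[where f = "\<lambda>a b. sin a - sin b"]) (simp_all add: field_simps)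
    then show ?thesis by (simp add: sin_add sin_diff)
  qed
  have "2 * sin (real r * t / 2) * (\<Sum>k. c k * cos ((real k + 1/2) * t))
      = (\<Sum>k. 2 * sin (real r * t / 2) * (c k * cos ((real k + 1/2) * t)))"
    using sumc by (rule suminf_mult[symmetric])
  also have "\<dots> = (\<Sum>k. c k * s (k + r) - c k * s k)"
  proof (intro arg_cong[where f = suminf] ext)
    show "2 * sin (real r * t / 2) * (c k * cos ((real k + 1/2) * t)) = c k * s (k + r) - c k * s k" for k
      using arg_cong[OF diff[of k], of "\<lambda>z. c k * z"] by (simp add: algebra_simps)
  qed
  also have "\<dots> = (\<Sum>k. c k * s (k + r)) - (\<Sum>k. c k * s k)"
    using sum1 sum2 by (rule suminf_diff[symmetric])
  \<comment> \<open>Splitting off the first r terms aligns the sines, so the coefficients combine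
    into c(k) - c(k + r). The boundary part is at most a block sum, hence again at most the
    variation; the resulting 2 A cancels against the factor 2.\<close>
  also have "(\<Sum>k. c k * s k) = (\<Sum>k. c (k + r) * s (k + r)) + (\<Sum>k<r. c k * s k)"
    using suminf_split_initial_segment[OF sum2, of r] by simp
  finally have "2 * sin (real r * t / 2) * (\<Sum>k. c k * cos ((real k + 1/2) * t))
      = (\<Sum>k. (c k - c (k + r)) * s (k + r)) - (\<Sum>k<r. c k * s k)"
    using suminf_diff[OF sum1 sum3] by (simp add: algebra_simps)
  moreover have "\<bar>\<Sum>k. (c k - c (k + r)) * s (k + r)\<bar> \<le> ?A"
  proof -
    have le: "norm ((c k - c (k + r)) * s (k + r)) \<le> \<bar>c k - c (k + r)\<bar>" for k
      using mult_left_mono[OF s1[of "k + r"], of "\<bar>c k - c (k + r)\<bar>"] by (simp add: abs_mult)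
    have sn: "summable (\<lambda>k. norm ((c k - c (k + r)) * s (k + r)))"
      by (rule summable_comparison_test'[OF summable_abs_shift_diff[OF c, of r]]) (use le in simp)
    have "norm (\<Sum>k. (c k - c (k + r)) * s (k + r)) \<le> (\<Sum>k. norm ((c k - c (k + r)) * s (k + r)))"
      using sn by (rule summable_norm)
    also have "\<dots> \<le> ?A"
      using le sn summable_abs_shift_diff[OF c] by (intro suminf_le) auto
    finally show ?thesis by simp
  qed
  moreover have "\<bar>\<Sum>k<r. c k * s k\<bar> \<le> ?A"
  proof -
    have "\<bar>\<Sum>k<r. c k * s k\<bar> \<le> (\<Sum>k<r. c k)"
    proof (rule order.trans[OF sum_abs], rule sum_mono)
      show "\<bar>c k * s k\<bar> \<le> c k" for k
        using mult_left_mono[OF s1[of k] c(2)[of k]] c(2)[of k] by (simp add: abs_mult)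
    qed
    also have "\<dots> \<le> ?A"
      using sum_block_le_suminf_abs_shift_diff[OF c, where l = 0] by simp
    finally show ?thesis .
  qed
  ultimately have "\<bar>2 * sin (real r * t / 2) * (\<Sum>k. c k * cos ((real k + 1/2) * t))\<bar> \<le> 2 * ?A"
    by linarith
  then show ?thesis by (simp add: abs_mult)
qed

section \<open>Integral representation of conjugate partial sums\<close>

lemma periodic_of_int:
  fixes g :: "real \<Rightarrow> 'b"
  assumes "\<And>t. g (t + P) = g t"
  shows "g (t + of_int k * P) = g t"
proof (induction k rule: int_induct[where k = 0])
  case (step1 i)
  have "g (t + of_int (i + 1) * P) = g ((t + of_int i * P) + P)" by (simp add: algebra_simps)
  also have "\<dots> = g t" using assms step1 by simp
  finally show ?case .
next
  case (step2 i)
  have "g (t + of_int (i - 1) * P) = g ((t + of_int (i - 1) * P) + P)" using assms by simp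
  also have "\<dots> = g (t + of_int i * P)" by (simp add: algebra_simps)
  finally show ?case using step2 by simp
qed simp

lemma periodic_has_integral_shift:
  fixes g :: "real \<Rightarrow> real"
  assumes "\<And>t. g (t + P) = g t" "(g has_integral I) {a..b}"
  shows "(g has_integral I) {a + of_int k * P..b + of_int k * P}"
  using has_integral_shift_real_ivl[OF assms(2), of "- (of_int k * P)"] periodic_of_int[of g P _ "-k"] assms(1)
  by simp

lemma periodic_integrable_on:
  fixes g :: "real \<Rightarrow> real"
  assumes per: "\<And>t. g (t + 2*pi) = g t" and int: "g integrable_on {-pi..pi}"
  shows "g integrable_on {a..b}"
proof -
  obtain I where I: "(g has_integral I) {-pi..pi}" using int by (auto simp: integrable_on_def)
  have step: "g integrable_on {-pi + of_int k * (2*pi)..pi + of_int k * (2*pi)}" for k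
    using periodic_has_integral_shift[of g "2*pi", OF per I] by (auto simp: integrable_on_def)
  have "g integrable_on {-pi - real n * (2*pi)..pi + real n * (2*pi)}" for n
  proof (induction n)
    case 0
    then show ?case using int by simp
  next
    case (Suc n)
    have eq: "pi + real n * (2*pi) = -pi + of_int (int (Suc n)) * (2*pi)"
      "-pi - real n * (2*pi) = pi + of_int (- int (Suc n)) * (2*pi)"
      "-pi - real (Suc n) * (2*pi) = -pi + of_int (- int (Suc n)) * (2*pi)"
      by (simp_all add: algebra_simps)
    have le: "0 \<le> real n * (2*pi)" "real n * (2*pi) \<le> real (Suc n) * (2*pi)"
      by (intro mult_nonneg_nonneg mult_right_mono; simp)+
    have "g integrable_on {pi + real n * (2*pi)..pi + real (Suc n) * (2*pi)}"
      using step[of "int (Suc n)"] unfolding eq(1) of_int_of_nat_eq .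
    then have A: "g integrable_on {-pi - real n * (2*pi)..pi + real (Suc n) * (2*pi)}"
      by (rule Henstock_Kurzweil_Integration.integrable_combine[OF _ _ Suc, rotated 2]) (use le pi_gt_zero in linarith)+
    have B: "g integrable_on {-pi - real (Suc n) * (2*pi)..-pi - real n * (2*pi)}"
      using step[of "- int (Suc n)"] by (simp only: eq(2,3))
    show ?case
      by (rule Henstock_Kurzweil_Integration.integrable_combine[OF _ _ B A]) (use le pi_gt_zero in linarith)+
  qed
  moreover obtain n :: nat where n: "max \<bar>a\<bar> \<bar>b\<bar> < real n" using reals_Archimedean2 by blast
  have "1 * real n \<le> (2*pi) * real n" using pi_gt3 by (intro mult_right_mono) auto
  then have "{a..b} \<subseteq> {-pi - real n * (2*pi)..pi + real n * (2*pi)}"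
    using n pi_gt3 by (auto simp: mult.commute)
  ultimately show ?thesis using integrable_on_subinterval by blast
qed

lemma periodic_absolutely_integrable_on:
  fixes g :: "real \<Rightarrow> real"
  assumes "\<And>t. g (t + 2*pi) = g t" "g absolutely_integrable_on {-pi..pi}"
  shows "g absolutely_integrable_on {a..b}"
  using periodic_integrable_on[of g] periodic_integrable_on[of "\<lambda>t. norm (g t)"] assms
  by (auto simp: absolutely_integrable_on_def)

text \<open>Whole periods bring the centre into [0, 2 pi]; the window is then cut at pi and the part
  beyond pi is moved back by one period.\<close>

lemma periodic_integral_shift:
  fixes g :: "real \<Rightarrow> real"
  assumes per: "\<And>t. g (t + 2*pi) = g t" and int: "g integrable_on {-pi..pi}"
  shows "integral {x - pi..x + pi} g = integral {-pi..pi} g"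
proof -
  have I: "g integrable_on {a..b}" for a b by (rule periodic_integrable_on[OF assms])
  have shift: "integral {a + of_int k * (2*pi)..b + of_int k * (2*pi)} g = integral {a..b} g" for a b k
    using periodic_has_integral_shift[of g "2*pi" _ a b k, OF per] I[of a b]
    by (intro integral_unique) (auto simp: has_integral_integral)
  define k where "k = \<lfloor>x / (2*pi)\<rfloor>"
  define y where "y = x - of_int k * (2*pi)"
  have "of_int k \<le> x / (2*pi)" "x / (2*pi) < of_int k + 1"
    unfolding k_def by linarith+
  then have y: "0 \<le> y" "y \<le> 2*pi"
    by (auto simp: y_def field_simps)
  have "integral {x - pi..x + pi} g = integral {y - pi..y + pi} g"
    using shift[of "y - pi" k "y + pi"] by (simp add: y_def algebra_simps)
  also have "\<dots> = integral {y - pi..pi} g + integral {pi..y + pi} g"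
    using y by (intro Henstock_Kurzweil_Integration.integral_combine[symmetric] I) auto
  also have "integral {pi..y + pi} g = integral {-pi..y - pi} g"
    using shift[of "-pi" 1 "y - pi"] by (simp add: algebra_simps)
  also have "integral {y - pi..pi} g + integral {-pi..y - pi} g = integral {-pi..pi} g"
    using y I Henstock_Kurzweil_Integration.integral_combine[of "-pi" "y - pi" pi g] by simp
  finally show ?thesis .
qed

section \<open>Absolute integrability of f and of its symmetric difference\<close>

lemma Lp_periodic_absolutely_integrable:
  assumes "Lp_periodic p f" "p \<ge> 1"
  shows "f absolutely_integrable_on {a..b}"
proof (rule periodic_absolutely_integrable_on)
  show "f (t + 2*pi) = f t" for t using assms by (auto simp: Lp_periodic_def)
  have m: "f \<in> borel_measurable lebesgue" and i: "(\<lambda>t. \<bar>f t\<bar> powr p) absolutely_integrable_on {-pi..pi}"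
    using assms by (auto simp: Lp_periodic_def)
  show "f absolutely_integrable_on {-pi..pi}"
  proof (rule measurable_bounded_by_integrable_imp_absolutely_integrable)
    show "f \<in> borel_measurable (lebesgue_on {-pi..pi})" using m by (rule measurable_restrict_space1)
    \<comment> \<open>On a bounded interval 1 + |f|^p is an integrable majorant of |f|, whether |f|
      is below or above 1.\<close>
    show "(\<lambda>t. 1 + \<bar>f t\<bar> powr p) integrable_on {-pi..pi}"
      using i by (intro integrable_add set_lebesgue_integral_eq_integral) auto
    show "norm (f t) \<le> 1 + \<bar>f t\<bar> powr p" for t
    proof (cases "\<bar>f t\<bar> \<le> 1")
      case False
      then have "\<bar>f t\<bar> powr 1 \<le> \<bar>f t\<bar> powr p" using assms by (intro powr_mono) auto
      then show ?thesis using False by simp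
    qed (simp add: add_increasing2)
  qed simp
qed

lemma psi_absolutely_integrable:
  assumes "Lp_periodic p f" "p \<ge> 1"
  shows "psi f x absolutely_integrable_on {a..b}"
proof -
  have f: "f absolutely_integrable_on {a..b}" for a b
    using assms by (rule Lp_periodic_absolutely_integrable)
  have sh: "(\<lambda>t. g (t + x)) absolutely_integrable_on {a..b}"
    if "g absolutely_integrable_on {a + x..b + x}" for g :: "real \<Rightarrow> real" and a b x
  proof -
    have *: "(\<lambda>t. h (t + x)) integrable_on {a..b}" if "h integrable_on {a + x..b + x}" for h :: "real \<Rightarrow> real"
      using has_integral_integrable[OF has_integral_shift_real_ivl[OF integrable_integral[OF that], of x]] by simp
    show ?thesis
      using that *[of g] *[of "\<lambda>t. norm (g t)"] unfolding absolutely_integrable_on_def by blast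
  qed
  have 1: "(\<lambda>t. f (t + x)) absolutely_integrable_on {a..b}" by (rule sh[OF f])
  have "(\<lambda>t. f (t + x)) absolutely_integrable_on {-b..-a}" by (rule sh[OF f])
  then have "(\<lambda>t. f (- t + x)) absolutely_integrable_on {a..b}"
    using absolutely_integrable_reflect_real[where f = "\<lambda>t. f (- t + x)" and a = a and b = b] by simp
  then show ?thesis using set_integral_diff(1)[OF 1]
    by (simp add: psi_def[abs_def] add.commute)
qed

lemma absolutely_integrable_mult_continuous:
  fixes g h :: "real \<Rightarrow> real"
  assumes "g absolutely_integrable_on {a..b}" "continuous_on {a..b} h"
  shows "(\<lambda>t. g t * h t) absolutely_integrable_on {a..b}"
proof -
  have "(\<lambda>t. h t * g t) absolutely_integrable_on {a..b}"
  proof (rule absolutely_integrable_bounded_measurable_product_real)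
    show "h \<in> borel_measurable (lebesgue_on {a..b})"
      using assms(2) by (rule continuous_imp_measurable_on_sets_lebesgue) simp
    show "bounded (h ` {a..b})"
      using assms(2) by (intro compact_imp_bounded compact_continuous_image) auto
  qed (use assms in auto)
  then show ?thesis by (simp add: mult.commute)
qed

text \<open>The addition formula merges the two coefficients into the integral of f(t) sin(\<nu> (x
  - t)). By periodicity the window may be centred at x; folding its left half onto [0, pi] turns f
  into \<open>psi\<close>, because the sine is odd.\<close>

lemma conj_coefficient_eq:
  assumes f: "Lp_periodic p f" "p \<ge> 1"
  shows "four_a f \<nu> * sin (real \<nu> * x) - four_b f \<nu> * cos (real \<nu> * x)
    = - (1/pi) * (LINT t:{0..pi}|lebesgue. psi f x t * sin (real \<nu> * t))"
proof -
  define g where "g t = f t * sin (real \<nu> * (x - t))" for t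
  have per: "f (t + 2*pi) = f t" for t using f by (auto simp: Lp_periodic_def)
  have fi: "f absolutely_integrable_on {a..b}" for a b
    using f by (rule Lp_periodic_absolutely_integrable)
  have gi: "g absolutely_integrable_on {a..b}" for a b
    unfolding g_def[abs_def] by (intro absolutely_integrable_mult_continuous fi continuous_intros)
  have gI: "g integrable_on {a..b}" for a b using gi by (rule set_lebesgue_integral_eq_integral)
  have gper: "g (t + 2*pi) = g t" for t
  proof -
    have "sin (real \<nu> * (x - (t + 2*pi))) = sin (real \<nu> * (x - t) - 2*pi * real \<nu>)"
      by (simp add: algebra_simps)
    also have "\<dots> = sin (real \<nu> * (x - t))"
      using sin_2npi[of \<nu>] cos_2npi[of \<nu>] by (simp add: sin_diff mult_ac)
    finally show ?thesis by (simp add: g_def per)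
  qed
  have c: "(\<lambda>t. f t * cos (real \<nu> * t)) absolutely_integrable_on {-pi..pi}"
    "(\<lambda>t. f t * sin (real \<nu> * t)) absolutely_integrable_on {-pi..pi}"
    by (intro absolutely_integrable_mult_continuous fi continuous_intros)+
  have e: "x - pi - x = -pi" "x + pi - x = pi" by simp_all
  have gs: "((\<lambda>t. g (t + x)) has_integral integral {x - pi..x + pi} g) {-pi..pi}"
    using has_integral_shift_real_ivl[OF integrable_integral[OF gI], of x "x - pi" "x + pi"]
    unfolding e .
  have "pi * (four_a f \<nu> * sin (real \<nu> * x) - four_b f \<nu> * cos (real \<nu> * x))
     = (LINT t:{-pi..pi}|lebesgue. (f t * cos (real \<nu> * t)) * sin (real \<nu> * x))
     - (LINT t:{-pi..pi}|lebesgue. (f t * sin (real \<nu> * t)) * cos (real \<nu> * x))"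
    by (simp add: four_a_def four_b_def right_diff_distrib)
  also have "\<dots> = (LINT t:{-pi..pi}|lebesgue. (f t * cos (real \<nu> * t)) * sin (real \<nu> * x) - (f t * sin (real \<nu> * t)) * cos (real \<nu> * x))"
    using c by (intro set_integral_diff(2)[symmetric] set_integrable_mult_left)
  also have "\<dots> = (LINT t:{-pi..pi}|lebesgue. g t)"
    by (intro set_lebesgue_integral_cong) (auto simp: g_def sin_diff right_diff_distrib mult_ac)
  also have "\<dots> = integral {-pi..pi} g" using gi by (rule set_lebesgue_integral_eq_integral)
  also have "\<dots> = integral {x - pi..x + pi} g"
    by (rule periodic_integral_shift[OF gper gI, symmetric])
  also have "\<dots> = integral {-pi..pi} (\<lambda>t. g (t + x))"
    using gs by (rule integral_unique[symmetric])
  also have "\<dots> = integral {-pi..0} (\<lambda>t. g (t + x)) + integral {0..pi} (\<lambda>t. g (t + x))"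
    using has_integral_integrable[OF gs]
    by (intro Henstock_Kurzweil_Integration.integral_combine[symmetric]) simp_all
  also have "integral {-pi..0} (\<lambda>t. g (t + x)) = integral {0..pi} (\<lambda>t. g (- t + x))"
    using Henstock_Kurzweil_Integration.integral_reflect_real[of pi 0 "\<lambda>t. g (- t + x)"] by simp
  also have "integral {0..pi} (\<lambda>t. g (- t + x)) + integral {0..pi} (\<lambda>t. g (t + x))
      = integral {0..pi} (\<lambda>t. g (- t + x) + g (t + x))"
  proof (rule Henstock_Kurzweil_Integration.integral_add[symmetric])
    have i: "(\<lambda>t. g (t + x)) integrable_on {a..b}" for a b
      using has_integral_shift_real_ivl[OF integrable_integral[OF gI], of x "a + x" "b + x"]
      by (auto simp: integrable_on_def)
    show "(\<lambda>t. g (t + x)) integrable_on {0..pi}" by (rule i)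
    show "(\<lambda>t. g (- t + x)) integrable_on {0..pi}"
      using i[of "-pi" 0] Henstock_Kurzweil_Integration.integrable_reflect_real[of "\<lambda>t. g (- t + x)" pi 0]  by simp
  qed
  also have "(\<lambda>t. g (- t + x) + g (t + x)) = (\<lambda>t. - (psi f x t * sin (real \<nu> * t)))"
    by (rule ext) (simp add: g_def psi_def algebra_simps)
  also have "integral {0..pi} (\<lambda>t. - (psi f x t * sin (real \<nu> * t))) = - integral {0..pi} (\<lambda>t. psi f x t * sin (real \<nu> * t))"
    by simp
  also have "integral {0..pi} (\<lambda>t. psi f x t * sin (real \<nu> * t)) = (LINT t:{0..pi}|lebesgue. psi f x t * sin (real \<nu> * t))"
    by (intro set_lebesgue_integral_eq_integral(2)[symmetric] absolutely_integrable_mult_continuous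
        psi_absolutely_integrable[OF f] continuous_intros)
  finally show ?thesis by (simp add: field_simps)
qed

lemma conj_partial_sum_eq:
  assumes f: "Lp_periodic p f" "p \<ge> 1"
  shows "conj_partial_sum f k x
    = - (1/pi) * (LINT t:{0..pi}|lebesgue. psi f x t * (\<Sum>\<nu>=1..k. sin (real \<nu> * t)))"
proof -
  have i: "set_integrable lebesgue {0..pi} (\<lambda>t. psi f x t * sin (real \<nu> * t))" for \<nu>
    by (intro absolutely_integrable_mult_continuous psi_absolutely_integrable[OF f] continuous_intros)
  have "(LINT t:{0..pi}|lebesgue. psi f x t * (\<Sum>\<nu>=1..k. sin (real \<nu> * t)))
     = (\<Sum>\<nu>=1..k. LINT t:{0..pi}|lebesgue. psi f x t * sin (real \<nu> * t))"
    using i unfolding set_lebesgue_integral_def set_integrable_def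
    by (subst Bochner_Integration.integral_sum[symmetric]) (auto simp: sum_distrib_left)
  then show ?thesis
    by (simp add: conj_partial_sum_def conj_coefficient_eq[OF f] sum_distrib_left)
qed

section \<open>The error kernel\<close>

definition conj_kernel :: "(nat \<Rightarrow> real) \<Rightarrow> real \<Rightarrow> real" where
  "conj_kernel c t = (\<Sum>k. c k * (\<Sum>\<nu>=1..k. sin (real \<nu> * t)))"

definition error_kernel :: "(nat \<Rightarrow> real) \<Rightarrow> real \<Rightarrow> real \<Rightarrow> real" where
  "error_kernel c \<delta> t = conj_kernel c t - (if \<delta> \<le> t then (1/2) * cot (t/2) else 0)"

text \<open>The first moment is what dominates the series of conjugate Dirichlet kernels.\<close>

lemma summable_of_square_weight:
  fixes c :: "nat \<Rightarrow> real"
  assumes "\<And>k. c k \<ge> 0" "summable (\<lambda>k. (real k + 1)^2 * c k)"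
  shows "summable (\<lambda>k. c k * real k)"
proof (rule summable_comparison_test'[OF assms(2)])
  fix k
  have "real k \<le> (real k + 1)^2" by (simp add: power2_eq_square algebra_simps)
  then show "norm (c k * real k) \<le> (real k + 1)^2 * c k"
    using assms(1)[of k] mult_right_mono[of "real k" "(real k + 1)^2" "c k"] by (simp add: abs_mult mult.commute)
qed

text \<open>The k-th conjugate Dirichlet kernel is at most k in absolute value, so the k-th summand
  has norm integral at most c(k) k times the integral of |psi|. The finite first moment therefore
  justifies exchanging sum and integral.\<close>

lemma suminf_conj_partial_sum_eq:
  fixes c :: "nat \<Rightarrow> real"
  assumes f: "Lp_periodic p f" "p \<ge> 1"
    and c: "\<And>k. c k \<ge> 0" "summable (\<lambda>k. (real k + 1)^2 * c k)"
  shows "set_integrable lebesgue {0..pi} (\<lambda>t. psi f x t * conj_kernel c t)"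
    and "(\<Sum>k. c k * conj_partial_sum f k x)
      = - (1/pi) * (LINT t:{0..pi}|lebesgue. psi f x t * conj_kernel c t)"
proof -
  define D where "D k t = (\<Sum>\<nu>=1..k. sin (real \<nu> * t))" for k and t :: real
  define F where "F k t = indicator {0..pi} t * (c k * (psi f x t * D k t))" for k t
  define J where "J = (LINT t:{0..pi}|lebesgue. \<bar>psi f x t\<bar>)"
  have D: "\<bar>D k t\<bar> \<le> real k" for k t
    unfolding D_def by (rule abs_sum_sin_le)
  have sk: "summable (\<lambda>k. c k * real k)" using c by (rule summable_of_square_weight)
  have psi: "psi f x absolutely_integrable_on {0..pi}" by (rule psi_absolutely_integrable[OF f])
  have pD: "set_integrable lebesgue {0..pi} (\<lambda>t. psi f x t * D k t)" for k
    unfolding D_def by (intro absolutely_integrable_mult_continuous psi continuous_intros)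
  have F_int: "integrable lebesgue (F k)" for k
    using set_integrable_mult_right[OF pD, of "c k" k] by (simp add: set_integrable_def F_def[abs_def])
  have psi_abs: "integrable lebesgue (\<lambda>t. indicator {0..pi} t * \<bar>psi f x t\<bar>)"
    using set_integrable_abs[OF psi] by (simp add: set_integrable_def)
  have F_le: "norm (F k t) \<le> c k * real k * (indicator {0..pi} t * \<bar>psi f x t\<bar>)" for k t
  proof -
    have "norm (F k t) = indicator {0..pi} t * (c k * (\<bar>psi f x t\<bar> * \<bar>D k t\<bar>))"
      using c(1)[of k] by (simp add: F_def abs_mult)
    also have "\<dots> \<le> indicator {0..pi} t * (c k * (\<bar>psi f x t\<bar> * real k))"
      using c(1)[of k] D[of k t] by (intro mult_left_mono) auto
    finally show ?thesis by (simp add: mult_ac)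
  qed
  have s1: "summable (\<lambda>k. norm (F k t))" for t
    by (rule summable_comparison_test'[OF summable_mult2[OF sk]]) (use F_le in simp)
  have s2: "summable (\<lambda>k. \<integral>t. norm (F k t) \<partial>lebesgue)"
  proof (rule summable_comparison_test'[OF summable_mult2[OF sk, of J]])
    fix k
    have "(\<integral>t. norm (F k t) \<partial>lebesgue) \<le> (\<integral>t. c k * real k * (indicator {0..pi} t * \<bar>psi f x t\<bar>) \<partial>lebesgue)"
      using F_int psi_abs F_le by (intro integral_mono) auto
    also have "\<dots> = c k * real k * J"
      by (simp add: J_def set_lebesgue_integral_def)
    finally show "norm (\<integral>t. norm (F k t) \<partial>lebesgue) \<le> c k * real k * J" by simp
  qed
  have F_sum: "(\<Sum>k. F k t) = indicator {0..pi} t * (psi f x t * conj_kernel c t)" for t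
  proof -
    have "summable (\<lambda>k. c k * D k t)"
      by (rule summable_comparison_test'[OF sk]) (use D c(1) in \<open>simp add: abs_mult mult_left_mono\<close>)
    then have "(\<Sum>k. (indicator {0..pi} t * psi f x t) * (c k * D k t)) = (indicator {0..pi} t * psi f x t) * conj_kernel c t"
      by (simp add: suminf_mult conj_kernel_def D_def)
    then show ?thesis by (simp add: F_def mult_ac)
  qed
  show "set_integrable lebesgue {0..pi} (\<lambda>t. psi f x t * conj_kernel c t)"
    using integrable_suminf[OF F_int _ s2] s1 by (simp add: set_integrable_def F_sum)
  have "(LINT t:{0..pi}|lebesgue. psi f x t * conj_kernel c t) = (\<integral>t. (\<Sum>k. F k t) \<partial>lebesgue)"
    by (simp add: set_lebesgue_integral_def F_sum)
  also have "\<dots> = (\<Sum>k. integral\<^sup>L lebesgue (F k))"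
    using s1 by (intro integral_suminf[OF F_int _ s2]) simp
  also have "\<dots> = (\<Sum>k. c k * (LINT t:{0..pi}|lebesgue. psi f x t * D k t))"
    by (simp add: F_def[abs_def] set_lebesgue_integral_def mult.left_commute[of "indicator _ _"])
  also have "\<dots> = (\<Sum>k. - pi * (c k * conj_partial_sum f k x))"
    by (simp add: conj_partial_sum_eq[OF f] D_def)
  also have "\<dots> = - pi * (\<Sum>k. c k * conj_partial_sum f k x)"
  proof (rule suminf_mult)
    \<comment> \<open>Pulling out -pi presupposes convergence, which follows from the summable
      integrals of the absolute values.\<close>
    have "summable (\<lambda>k. integral\<^sup>L lebesgue (F k))"
      using summable_comparison_test'[OF s2, of 0 "\<lambda>k. integral\<^sup>L lebesgue (F k)"] integral_norm_bound by blast
    also have "(\<lambda>k. integral\<^sup>L lebesgue (F k)) = (\<lambda>k. - pi * (c k * conj_partial_sum f k x))"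
      by (simp add: F_def[abs_def] set_lebesgue_integral_def mult.left_commute[of "indicator _ _"] conj_partial_sum_eq[OF f] D_def)
    finally show "summable (\<lambda>k. c k * conj_partial_sum f k x)"
      by (subst (asm) summable_cmult_iff) simp
  qed
  finally show "(\<Sum>k. c k * conj_partial_sum f k x)
      = - (1/pi) * (LINT t:{0..pi}|lebesgue. psi f x t * conj_kernel c t)"
    by (simp add: field_simps)
qed

lemma suminf_conj_partial_sum_minus_conj_trunc:
  fixes c :: "nat \<Rightarrow> real"
  assumes f: "Lp_periodic p f" "p \<ge> 1"
    and c: "\<And>k. c k \<ge> 0" "summable (\<lambda>k. (real k + 1)^2 * c k)"
    and \<delta>: "0 < \<delta>" "\<delta> \<le> pi"
  shows "set_integrable lebesgue {0..pi} (\<lambda>t. psi f x t * error_kernel c \<delta> t)"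
    and "(\<Sum>k. c k * conj_partial_sum f k x) - conj_trunc f x \<delta>
      = - (1/pi) * (LINT t:{0..pi}|lebesgue. psi f x t * error_kernel c \<delta> t)"
proof -
  let ?c = "\<lambda>t. (1/2) * cot (t/2)"
  have cot_int: "set_integrable lebesgue {\<delta>..pi} (\<lambda>t. psi f x t * ?c t)"
  proof (intro absolutely_integrable_mult_continuous psi_absolutely_integrable[OF f])
    show "continuous_on {\<delta>..pi} (\<lambda>t. 1/2 * cot (t/2))"
      unfolding cot_def
    proof (intro continuous_intros ballI)
      fix t assume "t \<in> {\<delta>..pi}"
      then have "sin (t/2) > 0" using \<delta> by (intro sin_gt_zero) auto
      then show "sin (t/2) \<noteq> 0" by simp
    qed auto
  qed
  \<comment> \<open>Extended by zero below \<delta>, the cotangent term becomes an integral over all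
    of [0, pi] and can be merged with the averaged kernel.\<close>
  let ?e = "\<lambda>t. psi f x t * (if \<delta> \<le> t then ?c t else 0)"
  have ind: "indicator {0..pi} t * ?e t = indicator {\<delta>..pi} t * (psi f x t * ?c t)" for t
    using \<delta> by (auto simp: indicator_def)
  have e_int: "set_integrable lebesgue {0..pi} ?e"
    and e_eq: "(LINT t:{0..pi}|lebesgue. ?e t) = (LINT t:{\<delta>..pi}|lebesgue. psi f x t * ?c t)"
    using cot_int by (simp_all only: set_integrable_def set_lebesgue_integral_def real_scaleR_def ind)
  have eq: "psi f x t * error_kernel c \<delta> t = psi f x t * conj_kernel c t - ?e t" for t
    by (simp add: error_kernel_def right_diff_distrib)
  note K = suminf_conj_partial_sum_eq[OF f c, where x = x]
  show "set_integrable lebesgue {0..pi} (\<lambda>t. psi f x t * error_kernel c \<delta> t)"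
    unfolding eq by (rule set_integral_diff(1)[OF K(1) e_int])
  have "(LINT t:{0..pi}|lebesgue. psi f x t * error_kernel c \<delta> t)
    = (LINT t:{0..pi}|lebesgue. psi f x t * conj_kernel c t) - (LINT t:{\<delta>..pi}|lebesgue. psi f x t * ?c t)"
    unfolding eq set_integral_diff(2)[OF K(1) e_int] e_eq ..
  then show "(\<Sum>k. c k * conj_partial_sum f k x) - conj_trunc f x \<delta>
      = - (1/pi) * (LINT t:{0..pi}|lebesgue. psi f x t * error_kernel c \<delta> t)"
    unfolding K(2) conj_trunc_def by (simp add: right_diff_distrib)
qed

lemma abs_conj_kernel_le:
  fixes c :: "nat \<Rightarrow> real"
  assumes c: "\<And>k. c k \<ge> 0" "summable (\<lambda>k. (real k + 1)^2 * c k)"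
  shows "\<bar>conj_kernel c t\<bar> \<le> (\<Sum>k. (real k + 1)^2 * c k) * \<bar>t\<bar>"
proof -
  have le: "norm (c k * (\<Sum>\<nu>=1..k. sin (real \<nu> * t))) \<le> (real k + 1)^2 * c k * \<bar>t\<bar>" for k
    using mult_left_mono[OF abs_sum_sin_le(2)[where k = k and t = t] c(1)[of k]] c(1)[of k] by (simp add: abs_mult mult_ac)
  have "norm (conj_kernel c t) \<le> (\<Sum>k. (real k + 1)^2 * c k * \<bar>t\<bar>)"
    unfolding conj_kernel_def by (rule norm_suminf_le[OF le summable_mult2[OF c(2)]])
  also have "\<dots> = (\<Sum>k. (real k + 1)^2 * c k) * \<bar>t\<bar>"
    by (rule suminf_mult2[OF c(2), symmetric])
  finally show ?thesis by simp
qed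

text \<open>The closed form of the sine sums is averaged. Since the weights have total mass 1, the
  cotangent appears with its full coefficient, and its removal leaves only the oscillating cosine
  average.\<close>

lemma conj_kernel_eq_cot:
  fixes c :: "nat \<Rightarrow> real"
  assumes c: "\<And>k. c k \<ge> 0" "c sums 1" and s: "sin (t/2) \<noteq> 0"
  shows "conj_kernel c t = (1/2) * cot (t/2) - (\<Sum>k. c k * cos ((real k + 1/2) * t)) / (2 * sin (t/2))"
proof -
  have sc: "summable (\<lambda>k. c k * cos ((real k + 1/2) * t))"
  proof (rule summable_comparison_test'[OF sums_summable[OF c(2)]])
    show "norm (c k * cos ((real k + 1/2) * t)) \<le> c k" for k
      using mult_left_mono[OF abs_cos_le_one c(1)[of k]] c(1)[of k] by (simp add: abs_mult)
  qed
  have "(\<lambda>k. (c k * cos (t/2) - c k * cos ((real k + 1/2) * t)) / (2 * sin (t/2)))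
     sums ((1 * cos (t/2) - (\<Sum>k. c k * cos ((real k + 1/2) * t))) / (2 * sin (t/2)))"
    by (intro sums_divide sums_diff sums_mult2 c(2) summable_sums sc)
  also have "(\<lambda>k. (c k * cos (t/2) - c k * cos ((real k + 1/2) * t)) / (2 * sin (t/2)))
     = (\<lambda>k. c k * (\<Sum>\<nu>=1..k. sin (real \<nu> * t)))"
  proof
    fix k
    have "(\<Sum>\<nu>=1..k. sin (real \<nu> * t)) = (cos (t/2) - cos ((real k + 1/2) * t)) / (2 * sin (t/2))"
      using s by (subst eq_divide_eq) (simp only: sum_sin_closed_form[symmetric], simp add: mult_ac)
    then show "(c k * cos (t/2) - c k * cos ((real k + 1/2) * t)) / (2 * sin (t/2))
      = c k * (\<Sum>\<nu>=1..k. sin (real \<nu> * t))"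
      by (simp add: right_diff_distrib)
  qed
  finally show ?thesis
    by (simp add: conj_kernel_def sums_iff cot_def diff_divide_distrib)
qed

text \<open>The three summands of \<open>G\<close> have separate origins. For t < pi/N the cotangent
  is still present and Abel summation does not apply: |L| t <= C (N t)^2 gives C pi^2, and C^2 pi^3
  r arises from comparing |sin (r t / 2)| with A. For t >= pi/N the kernel is a cosine average
  divided by 2 sin (t/2), which gives pi.\<close>

lemma error_kernel_bounds:
  fixes c :: "nat \<Rightarrow> real" and C N t :: real and r :: nat
  defines "G \<equiv> C * pi^2 + C^2 * pi^3 * real r + pi"
  assumes c: "\<And>k. c k \<ge> 0" "c sums 1" "summable (\<lambda>k. (real k + 1)^2 * c k)"
    and sq: "(\<Sum>k. (real k + 1)^2 * c k) \<le> C * N^2"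
    and N: "N \<ge> 1" and C: "C \<ge> 0"
    and A: "A = (\<Sum>k. \<bar>c k - c (k + r)\<bar>)" "1 \<le> C * N * A"
    and t: "0 < t" "t \<le> pi"
  shows "t \<le> pi/N \<Longrightarrow> \<bar>error_kernel c (pi/N) t\<bar> \<le> G * N^2 * t"
    and "\<bar>error_kernel c (pi/N) t\<bar> \<le> G / t"
    and "\<bar>error_kernel c (pi/N) t\<bar> * \<bar>sin (real r * t / 2)\<bar> \<le> G * A / t"
proof -
  let ?L = "error_kernel c (pi/N) t"
  have A0: "A \<ge> 0"
    unfolding A by (intro suminf_nonneg summable_abs_shift_diff sums_summable[OF c(2)] c(1)) simp
  have pi1: "pi \<ge> 1" using pi_gt3 by linarith
  have G: "C * pi^2 \<le> G" "C^2 * pi^3 * real r \<le> G" "pi \<le> G" "0 \<le> G"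
    using C by (auto simp: G_def)
  have C_le: "C \<le> G"
    using G(1) mult_left_mono[OF one_le_power[OF pi1, of 2] C] by linarith
  consider (small) "t < pi/N" | (large) "pi/N \<le> t" by linarith
  then have "(t \<le> pi/N \<longrightarrow> \<bar>?L\<bar> \<le> G * N^2 * t) \<and> \<bar>?L\<bar> \<le> G / t
    \<and> \<bar>?L\<bar> * \<bar>sin (real r * t / 2)\<bar> \<le> G * A / t"
  proof cases
    case small
    have Nt: "N * t \<le> pi" using small N by (simp add: field_simps)
    have "\<bar>?L\<bar> \<le> (\<Sum>k. (real k + 1)^2 * c k) * t"
      using small abs_conj_kernel_le[OF c(1,3), of t] t by (simp add: error_kernel_def)
    also have "\<dots> \<le> C * N^2 * t" using sq t by (intro mult_right_mono) auto
    finally have L: "\<bar>?L\<bar> \<le> C * N^2 * t" .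
    have "\<bar>?L\<bar> * t \<le> C * N^2 * t * t" using L t by (intro mult_right_mono) auto
    also have "\<dots> = C * (N * t)^2" by (simp add: power2_eq_square)
    also have "\<dots> \<le> C * pi^2" using Nt N t C by (intro mult_left_mono power_mono) auto
    finally have Lt: "\<bar>?L\<bar> * t \<le> C * pi^2" .
    \<comment> \<open>The factor A is produced here: the sine is O(r t), and 1 <= C N A is
      multiplied in, using N t <= pi.\<close>
    have "\<bar>sin (real r * t / 2)\<bar> \<le> \<bar>real r * t / 2\<bar>" by (rule abs_sin_x_le_abs_x)
    also have "\<dots> \<le> real r * t" using t by simp
    also have "\<dots> \<le> real r * t * (C * N * A)"
      using mult_left_mono[OF A(2), of "real r * t"] t by simp
    also have "\<dots> = real r * C * A * (N * t)" by simp
    also have "\<dots> \<le> real r * C * A * pi" using Nt C A0 by (intro mult_left_mono) auto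
    finally have s: "\<bar>sin (real r * t / 2)\<bar> \<le> real r * C * A * pi" .
    have "(\<bar>?L\<bar> * t) * \<bar>sin (real r * t / 2)\<bar> \<le> (C * pi^2) * (real r * C * A * pi)"
      by (rule mult_mono[OF Lt s]) (use C in auto)
    also have "\<dots> = (C^2 * pi^3 * real r) * A" by (simp add: power2_eq_square power3_eq_cube)
    also have "\<dots> \<le> G * A" using G A0 by (intro mult_right_mono) auto
    finally have 3: "\<bar>?L\<bar> * \<bar>sin (real r * t / 2)\<bar> * t \<le> G * A" by (simp add: mult_ac)
    have "C * N^2 * t \<le> G * N^2 * t" using C_le t by (intro mult_right_mono) auto
    then have 1: "\<bar>?L\<bar> \<le> G * N^2 * t" using L by linarith
    show ?thesis
      using 1 3 Lt G(1) t by (simp add: pos_le_divide_eq)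
  next
    case large
    let ?K = "\<Sum>k. c k * cos ((real k + 1/2) * t)"
    have st: "t / pi \<le> sin (t/2)" using sin_ge_two_pi_mult[of "t/2"] t by simp
    then have sp: "sin (t/2) > 0" using t by (smt (verit) divide_pos_pos pi_gt_zero)
    have L: "?L = - (?K / (2 * sin (t/2)))"
      using large conj_kernel_eq_cot[OF c(1,2), of t] sp by (simp add: error_kernel_def)
    have "norm ?K \<le> 1"
    proof -
      have "norm ?K \<le> suminf c"
      proof (rule norm_suminf_le[OF _ sums_summable[OF c(2)]])
        show "norm (c k * cos ((real k + 1/2) * t)) \<le> c k" for k
          using mult_left_mono[OF abs_cos_le_one c(1)[of k]] c(1)[of k] by (simp add: abs_mult)
      qed
      then show ?thesis using c(2) by (simp add: sums_iff)
    qed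
    then have K1: "\<bar>?K\<bar> \<le> 1" by simp
    have KA: "\<bar>sin (real r * t / 2)\<bar> * \<bar>?K\<bar> \<le> A"
      unfolding A by (rule abs_sin_mult_suminf_cos_le[OF sums_summable[OF c(2)] c(1)])
    have Lt: "\<bar>?L\<bar> * t \<le> pi * \<bar>?K\<bar>"
    proof -
      have "\<bar>?L\<bar> * t = \<bar>?K\<bar> * (t / (2 * sin (t/2)))" using sp by (simp add: L abs_mult)
      also have "\<dots> \<le> \<bar>?K\<bar> * pi"
      proof (rule mult_left_mono)
        have "t \<le> pi * sin (t/2)" using st by (simp add: field_simps)
        also have "\<dots> \<le> pi * (2 * sin (t/2))" using sp by simp
        finally show "t / (2 * sin (t/2)) \<le> pi" using sp by (simp add: pos_divide_le_eq)
      qed simp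
      finally show ?thesis by (simp add: mult.commute)
    qed
    also have "pi * \<bar>?K\<bar> \<le> pi" using K1 by simp
    finally have Lpi: "\<bar>?L\<bar> * t \<le> pi" .
    have "\<bar>?L\<bar> * \<bar>sin (real r * t / 2)\<bar> * t \<le> pi * (\<bar>sin (real r * t / 2)\<bar> * \<bar>?K\<bar>)"
      using mult_right_mono[OF Lt, of "\<bar>sin (real r * t / 2)\<bar>"] by (simp add: mult_ac)
    also have "\<dots> \<le> pi * A" using KA by (intro mult_left_mono) auto
    also have "\<dots> \<le> G * A" using G A0 by (intro mult_right_mono) auto
    finally have 3: "\<bar>?L\<bar> * \<bar>sin (real r * t / 2)\<bar> * t \<le> G * A" .
    \<comment> \<open>The two conditions on t meet only at t = pi/N, where the cotangent is already
      removed. There N t = pi exceeds 1, so the bound O(1/t) implies O(N^2 t).\<close>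
    have 1: "\<bar>?L\<bar> \<le> G * N^2 * t" if "t \<le> pi/N"
    proof -
      have "1 \<le> N * t" using large N pi1 by (simp add: field_simps)
      then have "1 \<le> (N * t)^2" by (rule one_le_power)
      have "\<bar>?L\<bar> * t \<le> G * (N * t)^2"
        using Lpi G(3,4) mult_left_mono[OF \<open>1 \<le> (N * t)^2\<close> G(4)] by linarith
      also have "\<dots> = (G * N^2 * t) * t" by (simp add: power2_eq_square)
      finally show ?thesis using t by simp
    qed
    show ?thesis
      using 1 3 Lpi G(3) t by (simp add: pos_le_divide_eq)
  qed
  then show "t \<le> pi/N \<Longrightarrow> \<bar>error_kernel c (pi/N) t\<bar> \<le> G * N^2 * t"
    and "\<bar>error_kernel c (pi/N) t\<bar> \<le> G / t"
    and "\<bar>error_kernel c (pi/N) t\<bar> * \<bar>sin (real r * t / 2)\<bar> \<le> G * A / t" by auto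
qed

section \<open>Estimates near the zeros of the sine\<close>

text \<open>With \<delta> = pi/N, t is rounded up to a multiple (j + 1) \<delta> and subadditivity
  gives (j + 1) w(\<delta>). The lower bound on t says 1 <= r t/\<delta>, so the rounding costs at
  most the summand r in 1 + r.\<close>

lemma modulus_type_le_linear:
  assumes w: "modulus_type w" and wpos: "\<forall>t\<in>{0<..2*pi}. w t > 0"
    and r: "r \<ge> 1" and N: "N \<ge> 1" and t: "pi / (real r * N) \<le> t" "t \<le> pi"
  shows "w t \<le> (1 + real r) * (N / pi) * w (pi/N) * t"
proof -
  define \<delta> where "\<delta> = pi/N"
  have \<delta>: "0 < \<delta>" "\<delta> \<le> pi" using N by (auto simp: \<delta>_def divide_le_eq)
  have mono: "w u \<le> w v" if "0 \<le> u" "u \<le> v" "v \<le> 2*pi" for u v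
    using w that unfolding modulus_type_def by (auto intro: mono_onD)
  have subadd: "w (real (Suc j) * \<delta>) \<le> real (Suc j) * w \<delta>" if "real (Suc j) * \<delta> \<le> 2*pi" for j
    using that
  proof (induction j)
    case (Suc j)
    have le: "real (Suc j) * \<delta> \<le> real (Suc (Suc j)) * \<delta>" using \<delta> by (intro mult_right_mono) auto
    \<comment> \<open>Subadditivity is assumed for ordered arguments, hence the check that \<delta>
      is the smaller one.\<close>
    have "1 * \<delta> \<le> real (Suc j) * \<delta>" using \<delta> by (intro mult_right_mono) auto
    moreover have "real (Suc (Suc j)) * \<delta> = \<delta> + real (Suc j) * \<delta>" by (simp add: algebra_simps)
    ultimately have "w (real (Suc (Suc j)) * \<delta>) \<le> w \<delta> + w (real (Suc j) * \<delta>)"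
      using w Suc.prems \<delta> unfolding modulus_type_def by auto
    also have "w (real (Suc j) * \<delta>) \<le> real (Suc j) * w \<delta>" using Suc le by linarith
    finally show ?case by (simp add: algebra_simps)
  qed simp
  have "0 < pi / (real r * N)" using r N by simp
  with t(1) have t0: "0 < t" by linarith
  define j where "j = nat \<lfloor>t/\<delta>\<rfloor>"
  have "0 \<le> t/\<delta>" using t0 \<delta> by simp
  then have j: "real j \<le> t/\<delta>" "t/\<delta> < real j + 1"
    unfolding j_def by linarith+
  have j1: "real j * \<delta> \<le> t" "t \<le> real (Suc j) * \<delta>"
    using j \<delta> by (simp_all add: pos_le_divide_eq pos_divide_less_eq algebra_simps)
  \<comment> \<open>Rounding up may leave [0, pi], but not [0, 2 pi], the domain of the
    modulus.\<close>
  have j2: "real (Suc j) * \<delta> \<le> 2*pi" using j1 t(2) \<delta>(2) by (simp add: algebra_simps)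
  have "w t \<le> w (real (Suc j) * \<delta>)" using j1 j2 t0 by (intro mono) auto
  also have "\<dots> \<le> real (Suc j) * w \<delta>" using j2 by (rule subadd)
  also have "\<dots> \<le> ((1 + real r) * (t/\<delta>)) * w \<delta>"
  proof (rule mult_right_mono)
    have "1 \<le> real r * (t/\<delta>)" using t(1) r N by (simp add: \<delta>_def field_simps)
    then show "real (Suc j) \<le> (1 + real r) * (t/\<delta>)" using j by (simp add: algebra_simps)
    have "w \<delta> > 0" using wpos \<delta> by auto
    then show "0 \<le> w \<delta>" by simp
  qed
  finally show ?thesis by (simp add: \<delta>_def mult_ac)
qed

section \<open>Inequalities that introduce the Hoelder weights\<close>

lemma le_mult_one_le:
  fixes a k :: real
  assumes "1 \<le> k" "0 \<le> a"
  shows "a \<le> a * k"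
  using mult_left_mono[OF assms] by simp

text \<open>In the applications \<tau> is the distance to a zero and s the absolute value of the
  sine. The power of s joins the function weighted in the hypothesis, the negative power of \<tau>
  becomes the dual function.\<close>

lemma one_le_powr_ratio:
  assumes "0 < \<tau>" "\<tau> \<le> pi * s" "e \<ge> 0"
  shows "1 \<le> pi powr e * (s powr e * \<tau> powr (-e))"
proof -
  have s: "s > 0" using assms(1,2) zero_less_mult_pos[of pi s] by simp
  have "1 \<le> (pi * s / \<tau>) powr e"
    using assms by (intro ge_one_powr_ge_zero) auto
  also have "\<dots> = pi powr e * (s powr e * \<tau> powr (-e))"
    using assms s by (simp add: powr_mult powr_divide powr_minus_divide)
  finally show ?thesis .
qed

text \<open>\<open>c\<close> is a zero of sin (r t / 2). Up to a shift by m pi the argument is r (t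
  - c) / 2, and |t - c| <= pi/r is the range of Jordan's inequality; the gained factor r is given
  away.\<close>

lemma abs_sin_ge_dist_node:
  fixes m r :: nat
  defines "c \<equiv> real (2 * m) * pi / real r"
  assumes r: "r \<ge> 1" and d: "\<bar>t - c\<bar> \<le> pi / real r"
  shows "\<bar>t - c\<bar> \<le> pi * \<bar>sin (real r * t / 2)\<bar>"
proof -
  let ?y = "real r * \<bar>t - c\<bar> / 2"
  have y: "0 \<le> ?y" "?y \<le> pi/2" using d r by (auto simp: field_simps)
  have "real r * t / 2 = real m * pi + real r * (t - c) / 2"
    using r by (simp add: c_def field_simps)
  then have "\<bar>sin (real r * t / 2)\<bar> = \<bar>sin (real r * (t - c) / 2)\<bar>"
    using abs_sin_npi_plus[of m "real r * (t - c) / 2"] by (simp only:)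
  also have "\<dots> = \<bar>sin ?y\<bar>"
  proof -
    have "?y = real r * (t - c) / 2 \<or> ?y = - (real r * (t - c) / 2)"
      by (auto simp: abs_if right_diff_distrib diff_divide_distrib)
    then show ?thesis by (elim disjE) (simp_all only: sin_minus abs_minus_cancel)
  qed
  finally have "\<bar>sin (real r * t / 2)\<bar> \<ge> 2/pi * ?y"
    using sin_ge_two_pi_mult[OF y] by linarith
  then have "real r * \<bar>t - c\<bar> \<le> pi * \<bar>sin (real r * t / 2)\<bar>"
    by (simp add: field_simps)
  moreover have "1 * \<bar>t - c\<bar> \<le> real r * \<bar>t - c\<bar>" using r by (intro mult_right_mono) auto
  ultimately show ?thesis by simp
qed

text \<open>Subadditivity suffices, so the pieces of the cover may share endpoints.\<close>

lemma nn_integral_Un_le: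
  fixes u :: "'a \<Rightarrow> ennreal"
  assumes u: "u \<in> borel_measurable M" and S: "S \<in> sets M" and T: "T \<in> sets M"
    and "0 \<le> a" "0 \<le> b"
    and "(\<integral>\<^sup>+t\<in>S. u t \<partial>M) \<le> ennreal a" "(\<integral>\<^sup>+t\<in>T. u t \<partial>M) \<le> ennreal b"
  shows "(\<integral>\<^sup>+t\<in>S \<union> T. u t \<partial>M) \<le> ennreal (a + b)"
proof -
  have "(\<integral>\<^sup>+t\<in>S \<union> T. u t \<partial>M) \<le> (\<integral>\<^sup>+t. u t * indicator S t + u t * indicator T t \<partial>M)"
    by (intro nn_integral_mono) (auto simp: indicator_def)
  also have "\<dots> = (\<integral>\<^sup>+t\<in>S. u t \<partial>M) + (\<integral>\<^sup>+t\<in>T. u t \<partial>M)"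
    using u S T by (intro nn_integral_add) auto
  also have "\<dots> \<le> ennreal a + ennreal b"
    using assms by (intro add_mono)
  finally show ?thesis using assms by simp
qed

lemma nn_integral_UN_le:
  fixes u :: "'a \<Rightarrow> ennreal"
  assumes u: "u \<in> borel_measurable M" and J: "finite J" and S: "\<And>j. S j \<in> sets M"
    and b: "0 \<le> b" "\<And>j. j \<in> J \<Longrightarrow> (\<integral>\<^sup>+t\<in>S j. u t \<partial>M) \<le> ennreal b"
  shows "(\<integral>\<^sup>+t\<in>(\<Union>j\<in>J. S j). u t \<partial>M) \<le> ennreal (real (card J) * b)"
  using J b(2)
proof (induction J)
  case (insert i J)
  have "(\<integral>\<^sup>+t\<in>S i \<union> (\<Union>j\<in>J. S j). u t \<partial>M) \<le> ennreal (b + real (card J) * b)"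
    using insert S b(1) by (intro nn_integral_Un_le u sets.finite_UN) auto
  then show ?case using insert by (simp add: algebra_simps)
qed simp

text \<open>The situation for one index n: N is n + 1, v the value w(pi/N), A the step-r variation
  of the row and L the error kernel. Of L only the size bounds are kept, which separates the Hoelder
  estimates from all questions about series.\<close>

locale kernel_estimate =
  fixes p q \<beta> \<gamma> C G A N v :: real and r :: nat and \<psi> L w :: "real \<Rightarrow> real"
  assumes p: "1 < p" and q: "q = p / (p - 1)"
    and \<beta>: "0 \<le> \<beta>" "\<beta> < 1 - 1/p" and \<gamma>: "\<gamma> < \<beta> + 1/p"
    and r: "1 \<le> r" and N: "1 \<le> N" and C: "0 < C" and G: "0 \<le> G" and A: "0 \<le> A" and v: "0 < v"
    and CNA: "1 \<le> C * N * A"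
    and w_pos: "\<And>t. 0 < t \<Longrightarrow> t \<le> pi \<Longrightarrow> 0 < w t"
    and w_le: "\<And>t. pi / (real r * N) \<le> t \<Longrightarrow> t \<le> pi \<Longrightarrow> w t \<le> (1 + real r) * (N / pi) * v * t"
    and w_small: "\<And>t. 0 < t \<Longrightarrow> t \<le> pi / (real r * N) \<Longrightarrow> w t \<le> v"
    and L_small: "\<And>t. 0 < t \<Longrightarrow> t \<le> pi / (real r * N) \<Longrightarrow> \<bar>L t\<bar> \<le> G * N^2 * t"
    and L_le: "\<And>t. 0 < t \<Longrightarrow> t \<le> pi \<Longrightarrow> \<bar>L t\<bar> \<le> G / t"
    and L_sin_le: "\<And>t. 0 < t \<Longrightarrow> t \<le> pi \<Longrightarrow> \<bar>L t\<bar> * \<bar>sin (real r * t / 2)\<bar> \<le> G * A / t"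
begin

abbreviation "H \<equiv> pi / (real r * N)"
abbreviation "W \<equiv> (1 + real r) * (N / pi) * v"
abbreviation "\<Phi> \<equiv> N powr (\<beta> + 1/p + 1) * A * v"

lemma H: "0 < H" "H \<le> pi / real r" "H \<le> pi"
proof -
  show "0 < H" using r N by simp
  have "real r * 1 \<le> real r * N" using N by (intro mult_left_mono) auto
  then show "H \<le> pi / real r" using r by (intro divide_left_mono) auto
  also have "pi / real r \<le> pi / 1" using r by (intro divide_left_mono) auto
  finally show "H \<le> pi" by simp
qed

text \<open>The two product inequalities are the strict hypotheses on \<beta> and \<gamma>,
  rewritten with 1/q = 1 - 1/p; they make the dual powers near and far from a zero
  integrable.\<close>

lemma q_props: "q > 0" "1/q = 1 - 1/p" "\<beta> * q < 1" "(1 + \<beta> - \<gamma>) * q > 1"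
proof -
  show q0: "q > 0" and iq: "1/q = 1 - 1/p" using p by (auto simp: q field_simps)
  have "\<beta> < 1/q" "1/q < 1 + \<beta> - \<gamma>" unfolding iq using \<beta> \<gamma> by linarith+
  then show "\<beta> * q < 1" "(1 + \<beta> - \<gamma>) * q > 1"
    using q0 by (simp_all add: pos_less_divide_eq pos_divide_less_eq)
qed

lemma H_powr: "H powr e = (pi / real r) powr e * N powr (-e)"
  using r N by (simp add: powr_divide powr_mult powr_minus_divide field_simps)

text \<open>This is where the lower bound \<open>A \<ge> 1 / (C N)\<close> pays for a missing factor \<open>A\<close>.\<close>

lemma powr_le_with_A:
  assumes "e \<le> \<beta> + 1/p"
  shows "N powr e * v \<le> C * \<Phi>"
proof -
  have "N powr e \<le> N powr (\<beta> + 1/p)" using N assms by (intro powr_mono) auto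
  also have "\<dots> \<le> N powr (\<beta> + 1/p) * (C * N * A)"
    using mult_left_mono[OF CNA, of "N powr (\<beta> + 1/p)"] by simp
  also have "\<dots> = C * (N powr (\<beta> + 1/p + 1) * A)"
    using N by (simp add: powr_add)
  finally show ?thesis using mult_right_mono[of _ _ v] v by (simp add: mult_ac)
qed

text \<open>\<open>H_powr\<close> separates the power of N from the norms of the dual powers; what
  remains is free of N, A and v. The second C in \<open>R_zero\<close> and \<open>R_near\<close> is
  the price of \<open>powr_le_with_A\<close>, which the far pieces do not pay.\<close>

definition "K_near = (1 - \<beta> * q) powr (-1/q) * (pi / real r) powr (1/q - \<beta>)"
definition "K_far = ((1 + \<beta> - \<gamma>) * q - 1) powr (-1/q) * (pi / real r) powr (1/q - (1 + \<beta> - \<gamma>))"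
definition "R_zero = G * pi powr \<beta> * C * K_near * C"
definition "R_near = G * ((1 + real r) / pi) * pi powr \<beta> * C * K_near * C"
definition "R_far = G * ((1 + real r) / pi) * pi powr (1 + \<beta>) * C * K_far"

lemma K_nonneg: "0 \<le> K_near" "0 \<le> K_far"
  by (simp_all add: K_near_def K_far_def)

lemma R_nonneg: "0 \<le> R_zero" "0 \<le> R_near" "0 \<le> R_far"
  using K_nonneg G C by (simp_all add: R_zero_def R_near_def R_far_def)

text \<open>The factor t of the kernel bound is absorbed by the t in the weight. The kernel
  contributes N^2, the hypothesis N^(-1) and the dual norm N^(\<beta> - 1/q), in total N^(\<beta> +
  1/p): the largest power that \<open>powr_le_with_A\<close> admits.\<close>

lemma near_zero_estimate:
  assumes g: "Lp_norm_le p {0..H} (\<lambda>t. (t * \<bar>\<psi> t\<bar> / w t) * sin (t/2) powr \<beta>) (C / N)"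
  shows "(\<integral>\<^sup>+t\<in>{0..H}. ennreal \<bar>\<psi> t * L t\<bar> \<partial>lebesgue) \<le> ennreal (R_zero * \<Phi>)"
proof -
  let ?K = "(1 - \<beta> * q) powr (-1/q) * H powr (1/q - \<beta>)"
  have "(\<integral>\<^sup>+t\<in>{0..H}. ennreal \<bar>\<psi> t * L t\<bar> \<partial>lebesgue)
     \<le> ennreal (G * N^2 * v * pi powr \<beta> * (C / N * ?K))"
  proof (rule nn_integral_le_Holder[OF p q _ _ _ g])
    show "Lp_norm_le q {0..H} (\<lambda>t. \<bar>t - 0\<bar> powr (-\<beta>)) ?K"
      using Lp_norm_le_powr_near(1)[of q H \<beta> 0] q_props H by simp
    show "0 < ?K" using q_props(3,4) r N by (intro mult_pos_pos) auto
    show "0 \<le> G * N^2 * v * pi powr \<beta>" using G v by simp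
    show "0 < C / N" using C N by simp
    fix t assume t: "0 < t" "t < H"
    then have tpi: "t \<le> pi" using H by linarith
    have "t / pi \<le> sin (t/2)" using sin_ge_two_pi_mult[of "t/2"] t tpi by simp
    then have s: "t \<le> pi * sin (t/2)" by (simp add: field_simps)
    have sp: "sin (t/2) \<ge> 0" using t tpi by (intro sin_ge_zero) auto
    have wt: "0 < w t" using w_pos t tpi by simp
    have "\<bar>\<psi> t * L t\<bar> \<le> \<bar>\<psi> t\<bar> * (G * N^2 * t)"
      unfolding abs_mult using L_small t by (intro mult_left_mono) auto
    \<comment> \<open>Up to H the modulus is at most v, so it is introduced by inserting the ratio v
      / w(t) >= 1.\<close>
    also have "\<dots> \<le> \<bar>\<psi> t\<bar> * (G * N^2 * t) * (v / w t)"
      using w_small[of t] t wt G by (intro le_mult_one_le) (auto simp: pos_le_divide_eq)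
    also have "\<dots> \<le> \<bar>\<psi> t\<bar> * (G * N^2 * t) * (v / w t) * (pi powr \<beta> * (sin (t/2) powr \<beta> * t powr (-\<beta>)))"
      using t wt G v by (intro le_mult_one_le one_le_powr_ratio[OF t(1) s \<beta>(1)]) auto
    also have "\<dots> = G * N^2 * v * pi powr \<beta> * (\<bar>(t * \<bar>\<psi> t\<bar> / w t) * sin (t/2) powr \<beta>\<bar> * \<bar>\<bar>t - 0\<bar> powr (-\<beta>)\<bar>)"
      using t wt by (simp add: abs_mult)
    finally show "\<bar>\<psi> t * L t\<bar> \<le> G * N^2 * v * pi powr \<beta>
        * (\<bar>(t * \<bar>\<psi> t\<bar> / w t) * sin (t/2) powr \<beta>\<bar> * \<bar>\<bar>t - 0\<bar> powr (-\<beta>)\<bar>)" .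
  qed
  also have "\<dots> \<le> ennreal (R_zero * \<Phi>)"
  proof (rule ennreal_leI)
    have "G * N^2 * v * pi powr \<beta> * (C / N * ?K) = (G * pi powr \<beta> * C * K_near) * ((N * N powr (- (1/q - \<beta>))) * v)"
      using N by (simp add: H_powr K_near_def power2_eq_square)
    also have "N * N powr (- (1/q - \<beta>)) = N powr (\<beta> + 1/p)"
      using N q_props(2) by (simp add: powr_mult_base)
    also have "(G * pi powr \<beta> * C * K_near) * (N powr (\<beta> + 1/p) * v) \<le> (G * pi powr \<beta> * C * K_near) * (C * \<Phi>)"
      using G C K_nonneg by (intro mult_left_mono powr_le_with_A) auto
    finally show "G * N^2 * v * pi powr \<beta> * (C / N * ?K) \<le> R_zero * \<Phi>" by (simp add: R_zero_def mult_ac)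
  qed
  finally show ?thesis .
qed

text \<open>Dividing by the sine is too costly this close to its zero, so L = O(1/t) is used.
  \<open>H \<le> lo\<close> permits w(t)/t = O(N v); then N, N^(-1/p) and N^(\<beta> - 1/q) multiply
  to N^\<beta>, which leaves room for supplying the missing A.\<close>

lemma near_node_estimate:
  fixes m :: nat
  defines "c \<equiv> real (2 * m) * pi / real r"
  assumes g: "Lp_norm_le p {lo..hi} (\<lambda>t. (\<bar>\<psi> t\<bar> / w t) * \<bar>sin (real r * t / 2)\<bar> powr \<beta>) (C * N powr (-1/p))"
    and lohi: "lo = c \<and> hi = c + H \<or> lo = c - H \<and> hi = c"
    and range: "H \<le> lo" "hi \<le> pi"
  shows "(\<integral>\<^sup>+t\<in>{lo..hi}. ennreal \<bar>\<psi> t * L t\<bar> \<partial>lebesgue) \<le> ennreal (R_near * \<Phi>)"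
proof -
  let ?K = "(1 - \<beta> * q) powr (-1/q) * H powr (1/q - \<beta>)"
  let ?s = "\<lambda>t. \<bar>sin (real r * t / 2)\<bar>"
  have W0: "0 < W" using N v by (auto intro!: mult_pos_pos simp: add_pos_nonneg)
  have "(\<integral>\<^sup>+t\<in>{lo..hi}. ennreal \<bar>\<psi> t * L t\<bar> \<partial>lebesgue)
     \<le> ennreal (G * W * pi powr \<beta> * (C * N powr (-1/p) * ?K))"
  proof (rule nn_integral_le_Holder[OF p q _ _ _ g])
    show "Lp_norm_le q {lo..hi} (\<lambda>t. \<bar>t - c\<bar> powr (-\<beta>)) ?K"
      using Lp_norm_le_powr_near[of q H \<beta> c] q_props H lohi by auto
    show "0 < ?K" using q_props(3,4) r N by (intro mult_pos_pos) auto
    show "0 \<le> G * W * pi powr \<beta>" using G N v by (intro mult_nonneg_nonneg) auto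
    show "0 < C * N powr (-1/p)" using C N by simp
    fix t assume t: "lo < t" "t < hi"
    then have tpi: "H \<le> t" "t \<le> pi" "0 < t" using range H by linarith+
    have "\<bar>t - c\<bar> \<le> pi / real r" using lohi t H by auto
    then have s: "\<bar>t - c\<bar> \<le> pi * ?s t"
      using abs_sin_ge_dist_node[OF r] unfolding c_def by blast
    have tc: "0 < \<bar>t - c\<bar>" using lohi t by auto
    have wt: "0 < w t" using w_pos tpi by simp
    \<comment> \<open>The linear bound on the modulus, in the form that cancels the 1/t of the
      kernel.\<close>
    have ratio: "1 \<le> W * t / w t" using w_le[OF tpi(1,2)] wt by (subst pos_le_divide_eq) auto
    have "\<bar>\<psi> t * L t\<bar> \<le> \<bar>\<psi> t\<bar> * (G / t)"
      unfolding abs_mult using L_le tpi by (intro mult_left_mono) auto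
    also have "\<dots> \<le> \<bar>\<psi> t\<bar> * (G / t) * (W * t / w t)"
      using tpi G by (intro le_mult_one_le ratio) auto
    also have "\<dots> = \<bar>\<psi> t\<bar> * G * (W / w t)" using tpi by simp
    also have "\<dots> \<le> \<bar>\<psi> t\<bar> * G * (W / w t) * (pi powr \<beta> * (?s t powr \<beta> * \<bar>t - c\<bar> powr (-\<beta>)))"
      using W0 wt G by (intro le_mult_one_le one_le_powr_ratio[OF tc s \<beta>(1)] mult_nonneg_nonneg[of "\<bar>\<psi> t\<bar> * G"] divide_nonneg_pos) auto
    also have "\<dots> = G * W * pi powr \<beta> * (\<bar>(\<bar>\<psi> t\<bar> / w t) * ?s t powr \<beta>\<bar> * \<bar>\<bar>t - c\<bar> powr (-\<beta>)\<bar>)"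
      using wt by (simp add: abs_mult)
    finally show "\<bar>\<psi> t * L t\<bar> \<le> G * W * pi powr \<beta> * (\<bar>(\<bar>\<psi> t\<bar> / w t) * ?s t powr \<beta>\<bar> * \<bar>\<bar>t - c\<bar> powr (-\<beta>)\<bar>)" .
  qed
  also have "\<dots> \<le> ennreal (R_near * \<Phi>)"
  proof (rule ennreal_leI)
    let ?R = "G * ((1 + real r) / pi) * pi powr \<beta> * C * K_near"
    have "G * W * pi powr \<beta> * (C * N powr (-1/p) * ?K)
        = ?R * ((N * (N powr (-1/p) * N powr (- (1/q - \<beta>)))) * v)"
      by (simp add: H_powr K_near_def)
    also have "N * (N powr (-1/p) * N powr (- (1/q - \<beta>))) = N powr \<beta>"
      using N q_props(2) by (simp add: powr_mult_base flip: powr_add)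
    also have "?R * (N powr \<beta> * v) \<le> ?R * (C * \<Phi>)"
      using G C K_nonneg p by (intro mult_left_mono powr_le_with_A) auto
    finally show "G * W * pi powr \<beta> * (C * N powr (-1/p) * ?K) \<le> R_near * \<Phi>" by (simp add: R_near_def mult_ac)
  qed
  finally show ?thesis .
qed

text \<open>The Abel bound takes one factor |sin| and the weight takes |sin|^\<beta>, so |t -
  c|^(-(1 + \<beta>)) is spent. The hypothesis covers |t - c|^(-\<gamma>) of it and the dual power
  the rest. The exponents 1, \<gamma> and 1 + \<beta> - \<gamma> - 1/q of N add up to \<beta> + 1/p
  + 1. \<open>g\<close> is kept separate because the hypotheses on the two sides of a zero write the
  weight differently.\<close>

lemma far_node_estimate:
  fixes m :: nat
  defines "c \<equiv> real (2 * m) * pi / real r"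
  assumes g: "Lp_norm_le p {lo..hi} g (C * N powr \<gamma>)"
    and g_eq: "\<And>t. lo < t \<Longrightarrow> t < hi \<Longrightarrow> g t = \<bar>\<psi> t\<bar> / (w t * \<bar>t - c\<bar> powr \<gamma>) * \<bar>sin (real r * t / 2)\<bar> powr \<beta>"
    and lohi: "lo = c + H \<and> hi = c + pi / real r \<or> lo = c - pi / real r \<and> hi = c - H"
    and range: "H \<le> lo" "hi \<le> pi"
  shows "(\<integral>\<^sup>+t\<in>{lo..hi}. ennreal \<bar>\<psi> t * L t\<bar> \<partial>lebesgue) \<le> ennreal (R_far * \<Phi>)"
proof -
  let ?e = "1 + \<beta> - \<gamma>"
  let ?K = "(?e * q - 1) powr (-1/q) * H powr (1/q - ?e)"
  let ?s = "\<lambda>t. \<bar>sin (real r * t / 2)\<bar>"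
  have "(\<integral>\<^sup>+t\<in>{lo..hi}. ennreal \<bar>\<psi> t * L t\<bar> \<partial>lebesgue)
     \<le> ennreal (G * A * W * pi powr (1 + \<beta>) * (C * N powr \<gamma> * ?K))"
  proof (rule nn_integral_le_Holder[OF p q _ _ _ g])
    show "Lp_norm_le q {lo..hi} (\<lambda>t. \<bar>t - c\<bar> powr (-?e)) ?K"
      using Lp_norm_le_powr_far[of q H "pi / real r" ?e c] q_props H lohi by auto
    show "0 < ?K" using q_props(3,4) r N by (intro mult_pos_pos) auto
    show "0 \<le> G * A * W * pi powr (1 + \<beta>)" using G A N v by (intro mult_nonneg_nonneg) auto
    show "0 < C * N powr \<gamma>" using C N by simp
    fix t assume t: "lo < t" "t < hi"
    then have tpi: "H \<le> t" "t \<le> pi" "0 < t" using range H by linarith+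
    have "\<bar>t - c\<bar> \<le> pi / real r" using lohi t H by auto
    then have s: "\<bar>t - c\<bar> \<le> pi * ?s t"
      using abs_sin_ge_dist_node[OF r] unfolding c_def by blast
    have tc: "0 < \<bar>t - c\<bar>" using lohi t H by auto
    have s0: "0 < ?s t" using s tc zero_less_mult_pos[of pi "?s t"] by simp
    have wt: "0 < w t" using w_pos tpi by simp
    have \<beta>1: "0 \<le> 1 + \<beta>" using \<beta> by simp
    have ratio: "1 \<le> W * t / w t" using w_le[OF tpi(1,2)] wt by (subst pos_le_divide_eq) auto
    let ?P = "pi powr (1 + \<beta>) * (?s t powr \<beta> * \<bar>t - c\<bar> powr (-(1 + \<beta>)))"
    have one: "1 \<le> ?s t * ?P"
      using one_le_powr_ratio[OF tc s \<beta>1] s0 by (simp add: powr_add mult_ac)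
    have "\<bar>\<psi> t * L t\<bar> \<le> \<bar>\<psi> t\<bar> * \<bar>L t\<bar> * (?s t * ?P)"
      using mult_left_mono[OF one, of "\<bar>\<psi> t\<bar> * \<bar>L t\<bar>"] by (simp add: abs_mult)
    also have "\<dots> = \<bar>\<psi> t\<bar> * (\<bar>L t\<bar> * ?s t) * ?P" by (simp only: mult.assoc)
    also have "\<dots> \<le> \<bar>\<psi> t\<bar> * (G * A / t) * ?P"
      using L_sin_le tpi by (intro mult_left_mono mult_right_mono) auto
    also have "\<dots> \<le> \<bar>\<psi> t\<bar> * (G * A / t) * ?P * (W * t / w t)"
      using tpi G A by (intro le_mult_one_le ratio) auto
    also have "\<dots> = \<bar>\<psi> t\<bar> * (G * A) * ?P * (W / w t)" using tpi by simp
    also have "\<bar>t - c\<bar> powr (-(1 + \<beta>)) = \<bar>t - c\<bar> powr (-?e) / \<bar>t - c\<bar> powr \<gamma>"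
      by (simp flip: powr_diff)
    also have "\<bar>\<psi> t\<bar> * (G * A) * (pi powr (1 + \<beta>) * (?s t powr \<beta> * (\<bar>t - c\<bar> powr (-?e) / \<bar>t - c\<bar> powr \<gamma>))) * (W / w t)
      = G * A * W * pi powr (1 + \<beta>) * (\<bar>g t\<bar> * \<bar>\<bar>t - c\<bar> powr (-?e)\<bar>)"
      using wt by (simp add: g_eq[OF t] abs_mult mult_ac)
    finally show "\<bar>\<psi> t * L t\<bar> \<le> G * A * W * pi powr (1 + \<beta>) * (\<bar>g t\<bar> * \<bar>\<bar>t - c\<bar> powr (-?e)\<bar>)" .
  qed
  also have "G * A * W * pi powr (1 + \<beta>) * (C * N powr \<gamma> * ?K) = R_far * \<Phi>"
  proof -
    have "G * A * W * pi powr (1 + \<beta>) * (C * N powr \<gamma> * ?K)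
      = R_far * ((N * (N powr \<gamma> * N powr (- (1/q - ?e)))) * A * v)"
      by (simp add: H_powr R_far_def K_far_def)
    also have "N * (N powr \<gamma> * N powr (- (1/q - ?e))) = N powr (\<beta> + 1/p + 1)"
      using N q_props(2) by (simp add: powr_mult_base add_ac flip: powr_add)
    finally show ?thesis .
  qed
  finally show ?thesis .
qed

section \<open>Covering [0, pi] and collecting the pieces\<close>

definition "R_total = R_zero + (real r + 1) * (2 * R_near + 2 * R_far)"

text \<open>The interval consists of r cells of length pi/r. A cell with even index 2 m starts at
  the zero c(m), one with odd index 2 m + 1 ends at c(m + 1), and each is split at distance H from
  that zero. The piece at the origin is treated apart; the four remaining families have at most r +
  1 members each, whence the shape of \<open>R_total\<close>.\<close>

lemma abs_integral_le:
  assumes int: "set_integrable lebesgue {0..pi} (\<lambda>t. \<psi> t * L t)"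
    and M: "M = (if odd r then {0..r div 2} else {0..<r div 2})"
    and zero: "Lp_norm_le p {0..H} (\<lambda>t. (t * \<bar>\<psi> t\<bar> / w t) * sin (t/2) powr \<beta>) (C / N)"
    and right_far: "\<And>m. m \<in> M \<Longrightarrow> Lp_norm_le p {real (2*m) * pi / real r + H..real (2*m) * pi / real r + pi / real r}
        (\<lambda>t. (\<bar>\<psi> t\<bar> / (w t * (t - real (2*m) * pi / real r) powr \<gamma>)) * \<bar>sin (real r * t / 2)\<bar> powr \<beta>) (C * N powr \<gamma>)"
    and right_near: "\<And>m. m \<in> M \<Longrightarrow> 2 \<le> r \<Longrightarrow> Lp_norm_le p {real (2*m) * pi / real r..real (2*m) * pi / real r + H}
        (\<lambda>t. (\<bar>\<psi> t\<bar> / w t) * \<bar>sin (real r * t / 2)\<bar> powr \<beta>) (C * N powr (-1/p))"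
    and left_near: "\<And>m. m < r div 2 \<Longrightarrow> Lp_norm_le p {real (2*(m+1)) * pi / real r - H..real (2*(m+1)) * pi / real r}
        (\<lambda>t. (\<bar>\<psi> t\<bar> / w t) * \<bar>sin (real r * t / 2)\<bar> powr \<beta>) (C * N powr (-1/p))"
    and left_far: "\<And>m. m < r div 2 \<Longrightarrow> Lp_norm_le p {real (2*(m+1)) * pi / real r - pi / real r..real (2*(m+1)) * pi / real r - H}
        (\<lambda>t. \<bar>\<psi> t\<bar> * \<bar>sin (real r * t / 2)\<bar> powr \<beta> / (w t * (real (2*(m+1)) * pi / real r - t) powr \<gamma>)) (C * N powr \<gamma>)"
  shows "\<bar>LINT t:{0..pi}|lebesgue. \<psi> t * L t\<bar> \<le> R_total * \<Phi>"
proof -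
  define c where "c m = real (2*m) * pi / real r" for m :: nat
  define h where "h = pi / real r"
  \<comment> \<open>Extension by zero makes the integrand measurable on the whole line, as the union
    bounds demand.\<close>
  define u where "u t = indicator {0..pi} t * (\<psi> t * L t)" for t
  have h: "H \<le> h" "0 < h" using H r by (auto simp: h_def)
  have c_eq: "c m = real (2*m) * h" for m by (simp add: c_def h_def)
  have r_h: "real r * h = pi" using r by (simp add: h_def)
  have mult_h_le: "real j * h \<le> pi" if "j \<le> r" for j
    using mult_right_mono[of "real j" "real r" h] that h r_h by simp
  have u_int: "integrable lebesgue u"
    using int by (simp add: set_integrable_def u_def[abs_def])
  then have u_meas: "(\<lambda>t. ennreal \<bar>u t\<bar>) \<in> borel_measurable lebesgue" by simp
  have u_le: "(\<integral>\<^sup>+t\<in>S. ennreal \<bar>u t\<bar> \<partial>lebesgue) \<le> b"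
    if "(\<integral>\<^sup>+t\<in>S. ennreal \<bar>\<psi> t * L t\<bar> \<partial>lebesgue) \<le> b" for S b
  proof (rule order.trans[OF nn_integral_mono that])
    show "ennreal \<bar>u t\<bar> * indicator S t \<le> ennreal \<bar>\<psi> t * L t\<bar> * indicator S t" for t
      by (auto simp: u_def indicator_def)
  qed
  have \<Phi>0: "0 \<le> \<Phi>" using A v by simp
  \<comment> \<open>The cell to the right of each zero indexed by M stays within [0, pi]. For even r
    the zero at pi has no such cell, and M stops before it.\<close>
  have M_le: "2*m + 1 \<le> r" if "m \<in> M" for m
    using that by (auto simp: M split: if_splits elim!: oddE evenE)
  have card_M: "card M \<le> r + 1" and fin_M: "finite M" by (auto simp: M)
  have cover: "{0..pi} \<subseteq> {0..H} \<union> ((\<Union>m\<in>M. {c m + H..c m + h}) \<union> ((\<Union>m\<in>M - {0}. {c m..c m + H})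
      \<union> ((\<Union>m\<in>{..<r div 2}. {c (m+1) - H..c (m+1)}) \<union> (\<Union>m\<in>{..<r div 2}. {c (m+1) - h..c (m+1) - H}))))"
    (is "_ \<subseteq> ?S")
  proof
    fix t assume t: "t \<in> {0..pi}"
    show "t \<in> ?S"
    proof (cases "t \<le> H")
      case True
      then show ?thesis using t by auto
    next
      case False
      \<comment> \<open>Ceiling minus one puts t into the half-open cell (j h, (j + 1) h], so that t
        = pi falls into the last cell j = r - 1.\<close>
      define j where "j = nat (\<lceil>t / h\<rceil> - 1)"
      have "0 < t / h" using False H h by auto
      then have j: "real j < t / h" "t / h \<le> real j + 1"
        unfolding j_def by linarith+
      have jt: "real j * h < t" "t \<le> real j * h + h"
        using j h by (simp_all add: pos_less_divide_eq pos_divide_le_eq algebra_simps)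
      have "real j * h < real r * h" using jt(1) t r_h by simp
      then have "j < r" using h by simp
      show ?thesis
      proof (cases "even j")
        case True
        then obtain m where m: "j = 2 * m" by (elim evenE)
        have mM: "m \<in> M" using \<open>j < r\<close> m by (auto simp: M elim!: oddE evenE)
        have ct: "c m < t" "t \<le> c m + h" using jt by (auto simp: c_eq m)
        show ?thesis
        proof (cases "c m + H \<le> t")
          case True
          then have "t \<in> {c m + H..c m + h}" using ct by auto
          then show ?thesis using mM by blast
        next
          case False2: False
          \<comment> \<open>For m = 0 the near piece is [0, H], which the present case t > H
            excludes.\<close>
          have "m \<noteq> 0" using False False2 by (cases m) (auto simp: c_def)
          then have "m \<in> M - {0}" "t \<in> {c m..c m + H}" using False2 ct mM by auto
          then show ?thesis by blast
        qed
      next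
        case False
        then obtain m where m: "j = 2 * m + 1" by (elim oddE)
        have mr: "m < r div 2" using \<open>j < r\<close> m by presburger
        have ct: "c (m+1) - h < t" "t \<le> c (m+1)"
          using jt by (auto simp: c_eq m algebra_simps)
        show ?thesis
          using ct mr by (cases "t \<le> c (m+1) - H") auto
      qed
    qed
  qed
  have b1: "(\<integral>\<^sup>+t\<in>{0..H}. ennreal \<bar>u t\<bar> \<partial>lebesgue) \<le> ennreal (R_zero * \<Phi>)"
    by (rule u_le, rule near_zero_estimate[OF zero])
  have b2: "(\<integral>\<^sup>+t\<in>{c m + H..c m + h}. ennreal \<bar>u t\<bar> \<partial>lebesgue) \<le> ennreal (R_far * \<Phi>)" if m: "m \<in> M" for m
  proof (rule u_le, rule far_node_estimate)
    show "Lp_norm_le p {c m + H..c m + h} (\<lambda>t. (\<bar>\<psi> t\<bar> / (w t * (t - c m) powr \<gamma>)) * \<bar>sin (real r * t / 2)\<bar> powr \<beta>) (C * N powr \<gamma>)"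
      using right_far[OF m] by (simp only: c_def h_def)
    show "c m + H = real (2*m) * pi / real r + H \<and> c m + h = real (2*m) * pi / real r + pi / real r
      \<or> c m + H = real (2*m) * pi / real r - pi / real r \<and> c m + h = real (2*m) * pi / real r - H"
      by (simp add: c_def h_def)
    show "H \<le> c m + H" using h by (simp add: c_eq)
    show "c m + h \<le> pi" using mult_h_le[OF M_le[OF m]] by (simp add: c_eq algebra_simps)
    show "(\<bar>\<psi> t\<bar> / (w t * (t - c m) powr \<gamma>)) * \<bar>sin (real r * t / 2)\<bar> powr \<beta>
      = \<bar>\<psi> t\<bar> / (w t * \<bar>t - real (2*m) * pi / real r\<bar> powr \<gamma>) * \<bar>sin (real r * t / 2)\<bar> powr \<beta>"
      if "c m + H < t" for t
      using that H(1) by (simp add: c_def)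
  qed
  have b3: "(\<integral>\<^sup>+t\<in>{c m..c m + H}. ennreal \<bar>u t\<bar> \<partial>lebesgue) \<le> ennreal (R_near * \<Phi>)" if m: "m \<in> M - {0}" for m
  proof (rule u_le, rule near_node_estimate)
    have m1: "m \<ge> 1" "m \<in> M" using m by auto
    \<comment> \<open>A nonzero index in M even forces r >= 3, so the hypothesis guarded by r >= 2
      is available.\<close>
    then have r2: "2 \<le> r" using M_le[of m] by linarith
    show "Lp_norm_le p {c m..c m + H} (\<lambda>t. (\<bar>\<psi> t\<bar> / w t) * \<bar>sin (real r * t / 2)\<bar> powr \<beta>) (C * N powr (-1/p))"
      using right_near[OF m1(2) r2] by (simp only: c_def)
    show "c m = real (2*m) * pi / real r \<and> c m + H = real (2*m) * pi / real r + H
      \<or> c m = real (2*m) * pi / real r - H \<and> c m + H = real (2*m) * pi / real r"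
      by (simp add: c_def)
    have "1 * h \<le> real (2*m) * h" using m1 h by (intro mult_right_mono) auto
    then show "H \<le> c m" using h unfolding c_eq by linarith
    show "c m + H \<le> pi" using mult_h_le[OF M_le[OF m1(2)]] h(1) by (simp add: c_eq algebra_simps)
  qed
  have b4: "(\<integral>\<^sup>+t\<in>{c (m+1) - H..c (m+1)}. ennreal \<bar>u t\<bar> \<partial>lebesgue) \<le> ennreal (R_near * \<Phi>)"
    if m: "m \<in> {..<r div 2}" for m
  proof (rule u_le, rule near_node_estimate)
    show "Lp_norm_le p {c (m+1) - H..c (m+1)} (\<lambda>t. (\<bar>\<psi> t\<bar> / w t) * \<bar>sin (real r * t / 2)\<bar> powr \<beta>) (C * N powr (-1/p))"
      using left_near[of m] m by (simp only: c_def lessThan_iff)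
    show "c (m+1) - H = real (2*(m+1)) * pi / real r \<and> c (m+1) = real (2*(m+1)) * pi / real r + H
      \<or> c (m+1) - H = real (2*(m+1)) * pi / real r - H \<and> c (m+1) = real (2*(m+1)) * pi / real r"
      by (simp add: c_def)
    have "2 * h \<le> real (2*(m+1)) * h" using h by (intro mult_right_mono) auto
    then show "H \<le> c (m+1) - H" using h unfolding c_eq by linarith
    show "c (m+1) \<le> pi" using mult_h_le[of "2*(m+1)"] m by (auto simp: c_eq)
  qed
  have b5: "(\<integral>\<^sup>+t\<in>{c (m+1) - h..c (m+1) - H}. ennreal \<bar>u t\<bar> \<partial>lebesgue) \<le> ennreal (R_far * \<Phi>)"
    if m: "m \<in> {..<r div 2}" for m
  proof (rule u_le, rule far_node_estimate)
    show "Lp_norm_le p {c (m+1) - h..c (m+1) - H}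
       (\<lambda>t. \<bar>\<psi> t\<bar> * \<bar>sin (real r * t / 2)\<bar> powr \<beta> / (w t * (c (m+1) - t) powr \<gamma>)) (C * N powr \<gamma>)"
      using left_far[of m] m by (simp only: c_def h_def lessThan_iff)
    show "c (m+1) - h = real (2*(m+1)) * pi / real r + H \<and> c (m+1) - H = real (2*(m+1)) * pi / real r + pi / real r
      \<or> c (m+1) - h = real (2*(m+1)) * pi / real r - pi / real r \<and> c (m+1) - H = real (2*(m+1)) * pi / real r - H"
      by (simp add: c_def h_def)
    have "2 * h \<le> real (2*(m+1)) * h" using h by (intro mult_right_mono) auto
    then show "H \<le> c (m+1) - h" using h unfolding c_eq by linarith
    have "c (m+1) \<le> pi" using mult_h_le[of "2*(m+1)"] m by (auto simp: c_eq)
    then show "c (m+1) - H \<le> pi" using H(1) by linarith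
    show "\<bar>\<psi> t\<bar> * \<bar>sin (real r * t / 2)\<bar> powr \<beta> / (w t * (c (m+1) - t) powr \<gamma>)
      = \<bar>\<psi> t\<bar> / (w t * \<bar>t - real (2*(m+1)) * pi / real r\<bar> powr \<gamma>) * \<bar>sin (real r * t / 2)\<bar> powr \<beta>"
      if "t < c (m+1) - H" for t
    proof -
      have "\<bar>t - c (m+1)\<bar> = c (m+1) - t" using that H(1) by linarith
      then show ?thesis by (simp only: c_def times_divide_eq_left)
    qed
  qed
  let ?B = "\<lambda>R. real (r + 1) * (R * \<Phi>)"
  have UN: "(\<integral>\<^sup>+t\<in>(\<Union>m\<in>J. S m). ennreal \<bar>u t\<bar> \<partial>lebesgue) \<le> ennreal (?B R)"
    if "finite J" "card J \<le> r + 1" "0 \<le> R" "\<And>m. S m \<in> sets lebesgue"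
      "\<And>m. m \<in> J \<Longrightarrow> (\<integral>\<^sup>+t\<in>S m. ennreal \<bar>u t\<bar> \<partial>lebesgue) \<le> ennreal (R * \<Phi>)" for J R and S :: "nat \<Rightarrow> real set"
  proof -
    have "(\<integral>\<^sup>+t\<in>(\<Union>m\<in>J. S m). ennreal \<bar>u t\<bar> \<partial>lebesgue) \<le> ennreal (real (card J) * (R * \<Phi>))"
      using that \<Phi>0 by (intro nn_integral_UN_le u_meas) auto
    also have "\<dots> \<le> ennreal (?B R)"
      using that \<Phi>0 by (intro ennreal_leI mult_right_mono) auto
    finally show ?thesis .
  qed
  have B0: "0 \<le> ?B R_far" "0 \<le> ?B R_near" "0 \<le> R_zero * \<Phi>"
    using R_nonneg \<Phi>0 by (auto intro!: mult_nonneg_nonneg)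
  have card_le: "card (M - {0}) \<le> r + 1" "card {..<r div 2} \<le> r + 1"
    using card_M card_Diff_subset[of "{0}" M] card_mono[OF fin_M, of "M - {0}"] by auto
  define S2 where "S2 = (\<Union>m\<in>M. {c m + H..c m + h})"
  define S3 where "S3 = (\<Union>m\<in>M - {0}. {c m..c m + H})"
  define S4 where "S4 = (\<Union>m\<in>{..<r div 2}. {c (m+1) - H..c (m+1)})"
  define S5 where "S5 = (\<Union>m\<in>{..<r div 2}. {c (m+1) - h..c (m+1) - H})"
  define S where "S = {0..H} \<union> (S2 \<union> (S3 \<union> (S4 \<union> S5)))"
  have sets [simp]: "S2 \<in> sets lebesgue" "S3 \<in> sets lebesgue" "S4 \<in> sets lebesgue" "S5 \<in> sets lebesgue"
    unfolding S2_def S3_def S4_def S5_def using fin_M by (auto intro!: sets.finite_UN)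
  have S2: "(\<integral>\<^sup>+t\<in>S2. ennreal \<bar>u t\<bar> \<partial>lebesgue) \<le> ennreal (?B R_far)"
    unfolding S2_def by (rule UN[OF fin_M card_M R_nonneg(3) _ b2]) auto
  have S3: "(\<integral>\<^sup>+t\<in>S3. ennreal \<bar>u t\<bar> \<partial>lebesgue) \<le> ennreal (?B R_near)"
    unfolding S3_def using fin_M by (intro UN[OF _ card_le(1) R_nonneg(2) _ b3]) auto
  have S4: "(\<integral>\<^sup>+t\<in>S4. ennreal \<bar>u t\<bar> \<partial>lebesgue) \<le> ennreal (?B R_near)"
    unfolding S4_def by (rule UN[OF _ card_le(2) R_nonneg(2) _ b4]) auto
  have S5: "(\<integral>\<^sup>+t\<in>S5. ennreal \<bar>u t\<bar> \<partial>lebesgue) \<le> ennreal (?B R_far)"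
    unfolding S5_def by (rule UN[OF _ card_le(2) R_nonneg(3) _ b5]) auto
  let ?T = "R_zero * \<Phi> + (?B R_far + (?B R_near + (?B R_near + ?B R_far)))"
  \<comment> \<open>The nonnegative integral is monotone in the set and subadditive over the cover,
    so the signed integral is left behind here.\<close>
  have "ennreal \<bar>integral\<^sup>L lebesgue u\<bar> \<le> (\<integral>\<^sup>+t. ennreal \<bar>u t\<bar> \<partial>lebesgue)"
    using integral_norm_bound_ennreal[OF u_int] by simp
  also have "\<dots> \<le> (\<integral>\<^sup>+t\<in>S. ennreal \<bar>u t\<bar> \<partial>lebesgue)"
  proof (rule nn_integral_mono)
    fix t
    have "{0..pi} \<subseteq> S" using cover unfolding S_def S2_def S3_def S4_def S5_def .
    then show "ennreal \<bar>u t\<bar> \<le> ennreal \<bar>u t\<bar> * indicator S t"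
      by (cases "t \<in> {0..pi}") (auto simp: u_def)
  qed
  also have "\<dots> \<le> ennreal ?T"
    unfolding S_def
    by (intro nn_integral_Un_le u_meas b1 S2 S3 S4 S5 B0 add_nonneg_nonneg sets.Un sets) simp
  finally have "\<bar>integral\<^sup>L lebesgue u\<bar> \<le> ?T"
    using B0 by (subst (asm) ennreal_le_iff) (intro add_nonneg_nonneg)
  also have "?T = R_total * \<Phi>"
    by (simp add: R_total_def algebra_simps)
  finally show ?thesis
    by (simp add: set_lebesgue_integral_def u_def[abs_def])
qed

end

section \<open>Application to the rows of the matrix, uniformly in n\<close>

theorem theorem2:
  fixes p \<beta> x :: real and r :: nat and f w :: "real \<Rightarrow> real" and a :: "nat \<Rightarrow> nat \<Rightarrow> real"
  assumes hp: "1 \<le> p"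
    and h\<beta>: "0 \<le> \<beta>" "\<beta> < 1 - 1/p"
    and hr: "r \<ge> 1"
    and hf: "Lp_periodic p f"
    and hw: "modulus_type w"
    and hwpos: "\<forall>t\<in>{0<..2*pi}. w t > 0"
    and hA: "summation_matrix a"
    and hyp: "\<exists>\<gamma> C. 0 < \<gamma> \<and> \<gamma> < \<beta> + 1/p \<and> (\<forall>n::nat.
       Lp_norm_le p {0..pi/(r*(n+1))}
         (\<lambda>t. (t * \<bar>psi f x t\<bar> / w t) * sin (t/2) powr \<beta>) (C / (n+1))
     \<and> (\<forall>m \<in> (if odd r then {0..r div 2} else {0..<r div 2}).
         Lp_norm_le p {2*m*pi/r + pi/(r*(n+1)) .. 2*m*pi/r + pi/r}
           (\<lambda>t. (\<bar>psi f x t\<bar> / (w t * (t - 2*m*pi/r) powr \<gamma>)) * \<bar>sin (r*t/2)\<bar> powr \<beta>)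
           (C * (n+1) powr \<gamma>))
     \<and> (r \<ge> 2 \<longrightarrow>
         Lq_norm_le p {0..pi/(r*(n+1))} (\<lambda>t. w t / (t * sin (r*t/2) powr \<beta>))
           (C * (n+1) powr (\<beta> + 1/p) * w (pi/(n+1)))
       \<and> (\<forall>m \<in> (if odd r then {0..r div 2} else {0..<r div 2}).
           Lp_norm_le p {2*m*pi/r .. 2*m*pi/r + pi/(r*(n+1))}
             (\<lambda>t. (\<bar>psi f x t\<bar> / w t) * \<bar>sin (r*t/2)\<bar> powr \<beta>)
             (C * (n+1) powr (-1/p))))
     \<and> (r \<ge> 2 \<longrightarrow> (\<forall>m \<in> {0..<r div 2}.
         Lp_norm_le p {2*(m+1)*pi/r - pi/(r*(n+1)) .. 2*(m+1)*pi/r}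
           (\<lambda>t. (\<bar>psi f x t\<bar> / w t) * \<bar>sin (r*t/2)\<bar> powr \<beta>)
           (C * (n+1) powr (-1/p))
       \<and> Lp_norm_le p {2*(m+1)*pi/r - pi/r .. 2*(m+1)*pi/r - pi/(r*(n+1))}
           (\<lambda>t. \<bar>psi f x t\<bar> * \<bar>sin (r*t/2)\<bar> powr \<beta> / (w t * (2*(m+1)*pi/r - t) powr \<gamma>))
           (C * (n+1) powr \<gamma>)))
     \<and> (\<Sum>l\<le>n. \<Sum>k=l..r+l-1. a n k) > 0
     \<and> inverse (\<Sum>l\<le>n. \<Sum>k=l..r+l-1. a n k) \<le> C
     \<and> summable (\<lambda>k. (real k + 1)^2 * a n k)
     \<and> (\<Sum>k. (real k + 1)^2 * a n k) \<le> C * (real n + 1)^2)"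
  shows "\<exists>C'. \<forall>n::nat. \<bar>T_conj a n f x - conj_trunc f x (pi/(n+1))\<bar>
           \<le> C' * (real n + 1) powr (\<beta> + 1/p + 1) * A_nr a n r * w (pi/(n+1))"
proof -
  have p: "1 < p"
  proof -
    have "1/p < 1" using h\<beta> by linarith
    then show ?thesis using hp by (simp add: divide_less_eq)
  qed
  from hyp show ?thesis
  proof (elim exE conjE, goal_cases)
    case (1 \<gamma> C)
    note \<gamma> = 1(2) and hyp_n = 1(3)
    define q where "q = p / (p - 1)"
    define G where "G = C * pi^2 + C^2 * pi^3 * real r + pi"
    \<comment> \<open>Only q, \<beta>, \<gamma>, C, G and r enter, none of which depends on n; hence
      one constant serves every n.\<close>
    define R where "R = kernel_estimate.R_total q \<beta> \<gamma> C G r"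
    have main: "\<bar>T_conj a n f x - conj_trunc f x (pi/(n+1))\<bar>
             \<le> R / pi * (real n + 1) powr (\<beta> + 1/p + 1) * A_nr a n r * w (pi/(n+1))" for n :: nat
    proof -
      define N where "N = real (n + 1)"
      define A where "A = A_nr a n r"
      have N: "1 \<le> N" and n1: "real n + 1 = N" and H_eq: "real (r * (n + 1)) = real r * N"
        by (simp_all add: N_def algebra_simps)
      have c: "\<And>k. a n k \<ge> 0" "a n sums 1" using hA by (auto simp: summation_matrix_def)
      let ?S = "\<Sum>l\<le>n. \<Sum>k=l..r+l-1. a n k"
      \<comment> \<open>Rewriting the coercions makes the endpoints agree literally with the
        intervals of the locale.\<close>
      note h = spec[OF hyp_n, of n, unfolded H_eq, folded N_def]
      note h1 = conjunct1[OF h] and h' = conjunct2[OF h]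
      note h2 = conjunct1[OF h'] and h'' = conjunct2[OF h']
      note h3 = conjunct1[OF h''] and h''' = conjunct2[OF h'']
      note h4 = conjunct1[OF h'''] and h5 = conjunct2[OF h''']
      note S = conjunct1[OF h5] conjunct1[OF conjunct2[OF h5]]
      note sq = conjunct2[OF conjunct2[OF h5], THEN conjunct1] conjunct2[OF conjunct2[OF h5], THEN conjunct2, unfolded n1]
      \<comment> \<open>C is positive because it bounds the inverse of a positive block sum.\<close>
      have C: "C > 0" using less_le_trans[OF positive_imp_inverse_positive[OF S(1)] S(2)] .
      have A0: "A \<ge> 0"
        unfolding A_def A_nr_def by (intro suminf_nonneg summable_abs_shift_diff sums_summable[OF c(2)] c(1)) simp
      have CNA: "1 \<le> C * N * A"
      proof -
        have "1 = inverse ?S * ?S" using S(1) by simp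
        also have "\<dots> \<le> C * ?S" using S by (intro mult_right_mono) auto
        also have "\<dots> \<le> C * (N * A)"
          unfolding A_def A_nr_def n1[symmetric]
          using C sum_blocks_le_suminf_abs_shift_diff[OF sums_summable[OF c(2)] c(1) hr] by (intro mult_left_mono) auto
        finally show ?thesis by (simp add: mult.assoc)
      qed
      have \<delta>: "0 < pi/N" "pi/N \<le> pi" using N by (auto simp: divide_le_eq)
      have H_le: "pi / (real r * N) \<le> pi / N"
      proof (rule divide_left_mono)
        show "N \<le> real r * N" using hr N by simp
      qed (use hr N in auto)
      have w_pos: "0 < w t" if "0 < t" "t \<le> pi" for t using that hwpos by auto
      note L = error_kernel_bounds[OF c sq N less_imp_le[OF C] A_def[unfolded A_nr_def] CNA, folded G_def]
      interpret kernel_estimate p q \<beta> \<gamma> C G A N "w (pi/N)" r "psi f x" "error_kernel (a n) (pi/N)" w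
      proof
        show "1 < p" by (rule p)
        show "q = p / (p - 1)" by (rule q_def)
        show "0 \<le> \<beta>" "\<beta> < 1 - 1/p" by (rule h\<beta>)+
        show "0 \<le> G" using C by (simp add: G_def)
        show "0 < w (pi/N)" using \<delta> by (intro w_pos) auto
        fix t :: real
        show "w t \<le> (1 + real r) * (N / pi) * w (pi/N) * t" if "pi / (real r * N) \<le> t" "t \<le> pi"
          using that by (intro modulus_type_le_linear[OF hw hwpos hr N])
        show "w t \<le> w (pi/N)" if "0 < t" "t \<le> pi / (real r * N)"
          using hw that H_le \<delta> unfolding modulus_type_def by (auto intro!: mono_onD[of _ w])
        show "\<bar>error_kernel (a n) (pi/N) t\<bar> \<le> G * N^2 * t" if "0 < t" "t \<le> pi / (real r * N)"
          using that H_le \<delta> by (intro L(1)) auto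
      qed (use \<gamma> hr N C A0 CNA w_pos L in auto)
      note eq = suminf_conj_partial_sum_minus_conj_trunc[OF hf hp c(1) sq(1) \<delta>, where x = x]
      have "\<bar>LINT t:{0..pi}|lebesgue. psi f x t * error_kernel (a n) (pi/N) t\<bar> \<le> R_total * (N powr (\<beta> + 1/p + 1) * A * w (pi/N))"
      proof (rule abs_integral_le[OF eq(1) refl h1])
        fix m
        show "Lp_norm_le p {real (2*m) * pi / real r + H..real (2*m) * pi / real r + pi / real r}
            (\<lambda>t. (\<bar>psi f x t\<bar> / (w t * (t - real (2*m) * pi / real r) powr \<gamma>)) * \<bar>sin (real r * t / 2)\<bar> powr \<beta>) (C * N powr \<gamma>)"
          if "m \<in> (if odd r then {0..r div 2} else {0..<r div 2})"
          by (rule bspec[OF h2 that])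
        show "Lp_norm_le p {real (2*m) * pi / real r..real (2*m) * pi / real r + H}
            (\<lambda>t. (\<bar>psi f x t\<bar> / w t) * \<bar>sin (real r * t / 2)\<bar> powr \<beta>) (C * N powr (-1/p))"
          if "m \<in> (if odd r then {0..r div 2} else {0..<r div 2})" "2 \<le> r"
          by (rule bspec[OF conjunct2[OF mp[OF h3 that(2)]] that(1)])
        \<comment> \<open>An index below r div 2 exists only for r >= 2, so the guarded hypothesis
          applies.\<close>
        have left: "m \<in> {0..<r div 2}" "2 \<le> r" if "m < r div 2" using that by auto
        show "Lp_norm_le p {real (2*(m+1)) * pi / real r - H..real (2*(m+1)) * pi / real r}
            (\<lambda>t. (\<bar>psi f x t\<bar> / w t) * \<bar>sin (real r * t / 2)\<bar> powr \<beta>) (C * N powr (-1/p))" if "m < r div 2"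
          by (rule conjunct1[OF bspec[OF mp[OF h4 left(2)[OF that]] left(1)[OF that]]])
        show "Lp_norm_le p {real (2*(m+1)) * pi / real r - pi / real r..real (2*(m+1)) * pi / real r - H}
            (\<lambda>t. \<bar>psi f x t\<bar> * \<bar>sin (real r * t / 2)\<bar> powr \<beta> / (w t * (real (2*(m+1)) * pi / real r - t) powr \<gamma>)) (C * N powr \<gamma>)"
          if "m < r div 2"
          by (rule conjunct2[OF bspec[OF mp[OF h4 left(2)[OF that]] left(1)[OF that]]])
      qed
      then have "(1/pi) * \<bar>LINT t:{0..pi}|lebesgue. psi f x t * error_kernel (a n) (pi/N) t\<bar>
         \<le> (1/pi) * (R_total * (N powr (\<beta> + 1/p + 1) * A * w (pi/N)))"
        by (intro mult_left_mono) auto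
      then have "\<bar>T_conj a n f x - conj_trunc f x (pi/N)\<bar> \<le> R / pi * N powr (\<beta> + 1/p + 1) * A * w (pi/N)"
        unfolding T_conj_def eq(2) R_def by (simp add: abs_mult)
      then show ?thesis
        unfolding n1 A_def N_def .
    qed
    show ?thesis
      by (intro exI[of _ "R / pi"] allI main)
  qed
qed

end
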